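(* Let $f:\mathbb{R}^d\to\mathbb{R}$ be differentiable and bounded from below, with $\nabla f$ Lipschitz continuous with parameter $\mathsf{L}>0$, and suppose that $f$ satisfies the Łojasiewicz inequality on $\mathrm{crit}(f)$ (see context). Let $\{\boldsymbol{x}^k\}_k$ be generated by the stochastic gradient method with momentum (SGDM, see context) with momentum parameters $\lambda\in[0,1)$ and $\nu\ge0$, where the stochastic errors satisfy $\mathbb{E}[\boldsymbol{e}^k\mid\mathcal{F}_k]=0$ and $\mathbb{E}[\|\boldsymbol{e}^k\|^2\mid\mathcal{F}_k]\le\sigma^2$ almost surely for all $k$ (for some constant $\sigma\ge0$), and where the step sizes $\{\alpha_k\}_k\subset(0,\infty)$ are non-increasing and satisfy $$\sum_{k=1}^\infty\alpha_k=\infty\quad\text{and}\quad\sum_{k=1}^\infty\alpha_k^2\Big(\sum_{i=1}^k\alpha_i\Big)^{2r}<\infty\quad\text{for some } r>\tfrac12.$$ Then the event $$\mathcal{I}=\Big\{\omega\in\Omega:\ \lim_{k\to\infty}\|\boldsymbol{x}^k(\omega)\|=\infty\ \text{ or }\ \boldsymbol{x}^k(\omega)\to x^*\text{ for some }x^*\in\mathrm{crit}(f)\Big\}$$ occurs with probability $1$.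
   Context: SGDM: on a probability space $(\Omega,\mathcal{F},\mathbb{P})$, with deterministic initial points $\boldsymbol{x}^1=\boldsymbol{x}^0=x^0\in\mathbb{R}^d$, deterministic step sizes $\alpha_k>0$ and parameters $\lambda\in[0,1)$, $\nu\ge0$, SGDM generates the stochastic process given for $k\ge1$ by $$\tilde{\boldsymbol{x}}^k=\boldsymbol{x}^k+\nu(\boldsymbol{x}^k-\boldsymbol{x}^{k-1}),\quad \boldsymbol{g}^k=\nabla f(\tilde{\boldsymbol{x}}^k)-\boldsymbol{e}^k,\quad \boldsymbol{x}^{k+1}=\boldsymbol{x}^k-\alpha_k\boldsymbol{g}^k+\lambda(\boldsymbol{x}^k-\boldsymbol{x}^{k-1}),$$ where $\boldsymbol{e}^k:\Omega\to\mathbb{R}^d$ are random vectors (stochastic errors). The filtration is $\mathcal{F}_k=\sigma(\boldsymbol{x}^0,\boldsymbol{x}^1,\dots,\boldsymbol{x}^k)$. $\mathrm{crit}(f)=\{x\in\mathbb{R}^d:\nabla f(x)=0\}$. The function $f$ satisfies the Łojasiewicz inequality on $\mathrm{crit}(f)$ if for every $x^*\in\mathrm{crit}(f)$ there are $\eta\in(0,\infty]$, a neighborhood $U(x^* )$ of $x^*$, a constant $\mathsf{C}_f=\mathsf{C}_f(x^* )>0$ and an exponent $\theta=\theta(x^* )\in[\frac12,1)$ (the Łojasiewicz exponent of $f$ at $x^*$) such that $\|\nabla f(x)\|\ge\mathsf{C}_f|f(x)-f(x^* )|^\theta$ for all $x\in U(x^* )$ with $0<|f(x)-f(x^* )|<\eta$.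 *)

theory Defs
  imports "HOL-Probability.Probability"
begin

definition grad :: "('a::real_inner \<Rightarrow> real) \<Rightarrow> 'a \<Rightarrow> 'a" where
  "grad f x = (THE D. GDERIV f x :> D)"

lemma grad_eqI:
  assumes "GDERIV f x :> D"
  shows "grad f x = D"
  unfolding grad_def
proof (rule the_equality)
  fix D' assume "GDERIV f x :> D'"
  with assms have "(\<lambda>h. h \<bullet> D') = (\<lambda>h. h \<bullet> D)"
    unfolding gderiv_def by (metis has_derivative_unique)
  then show "D' = D"
    by (metis vector_eq_ldot)
qed (rule assms)

lemma GDERIV_grad:
  fixes f :: "'a::euclidean_space \<Rightarrow> real"
  assumes "f differentiable (at x)"
  shows "GDERIV f x :> grad f x"
proof -
  obtain f' where f': "(f has_derivative f') (at x)"
    using assms by (auto simp: differentiable_def)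
  then have "linear f'"
    by (rule has_derivative_linear)
  then have "f' = (\<lambda>h. h \<bullet> adjoint f' 1)"
    using adjoint_works[of f'] by (metis inner_real_def mult_1_right)
  with f' have "GDERIV f x :> adjoint f' 1"
    unfolding gderiv_def by simp
  with grad_eqI[OF this] show ?thesis
    by simp
qed

definition crit :: "('a::real_inner \<Rightarrow> real) \<Rightarrow> 'a set" where
  "crit f = {x. grad f x = 0}"

definition Lojasiewicz_at :: "('a::real_inner \<Rightarrow> real) \<Rightarrow> 'a \<Rightarrow> bool" where
  "Lojasiewicz_at f z \<longleftrightarrow>
     (\<exists>(\<eta>::ereal) U C \<theta>. 0 < \<eta> \<and> open U \<and> z \<in> U \<and> 0 < C \<and> \<theta> \<in> {1/2..<1} \<and>
        (\<forall>x\<in>U. 0 < \<bar>f x - f z\<bar> \<and> ereal \<bar>f x - f z\<bar> < \<eta> \<longrightarrow>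
           norm (grad f x) \<ge> C * \<bar>f x - f z\<bar> powr \<theta>))"

text \<open>Index \<open>0\<close> of \<open>\<alpha>\<close> and \<open>e\<close> is never used: the recursion starts at \<open>k = 1\<close>.\<close>

definition SGDM ::
  "'w measure \<Rightarrow> ('a::real_inner \<Rightarrow> real) \<Rightarrow> (nat \<Rightarrow> real) \<Rightarrow> real \<Rightarrow> real \<Rightarrow> 'a \<Rightarrow>
   (nat \<Rightarrow> 'w \<Rightarrow> 'a) \<Rightarrow> (nat \<Rightarrow> 'w \<Rightarrow> 'a) \<Rightarrow> bool" where
  "SGDM M f \<alpha> lam \<nu> x0 e x \<longleftrightarrow>
     (\<forall>\<omega>\<in>space M. x 0 \<omega> = x0 \<and> x 1 \<omega> = x0 \<and>
        (\<forall>k\<ge>1.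
           let y = x k \<omega> + \<nu> *\<^sub>R (x k \<omega> - x (k - 1) \<omega>);
               g = grad f y - e k \<omega>
           in x (k + 1) \<omega> = x k \<omega> - \<alpha> k *\<^sub>R g + lam *\<^sub>R (x k \<omega> - x (k - 1) \<omega>)))"

definition natural_filtration ::
  "'w measure \<Rightarrow> (nat \<Rightarrow> 'w \<Rightarrow> 'a::topological_space) \<Rightarrow> nat \<Rightarrow> 'w measure" where
  "natural_filtration M x k =
     sigma (space M) {x i -` A \<inter> space M | i A. i \<le> k \<and> A \<in> sets borel}"

text \<open>Conditional expectation of a random vector, componentwise. As with
  \<^const>\<open>real_cond_exp\<close>, the value is only meaningful for integrable \<open>X\<close>.\<close>

definition vec_cond_exp ::
  "'w measure \<Rightarrow> 'w measure \<Rightarrow> ('w \<Rightarrow> 'a::euclidean_space) \<Rightarrow> 'w \<Rightarrow> 'a" where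
  "vec_cond_exp M F X \<omega> = (\<Sum>b\<in>Basis. real_cond_exp M F (\<lambda>\<omega>. X \<omega> \<bullet> b) \<omega> *\<^sub>R b)"

text \<open>The conditional second moment is taken with \<^const>\<open>nn_cond_exp\<close>, which may be infinite.
  The bound by \<open>\<sigma>\<^sup>2\<close> therefore forces the errors to be square integrable, hence integrable, so
  that the conditional means are meaningful.\<close>

definition stochastic_errors ::
  "'w measure \<Rightarrow> (nat \<Rightarrow> 'w measure) \<Rightarrow> real \<Rightarrow> (nat \<Rightarrow> 'w \<Rightarrow> 'a::euclidean_space) \<Rightarrow> bool" where
  "stochastic_errors M F \<sigma> e \<longleftrightarrow>
     (\<forall>k\<ge>1. e k \<in> borel_measurable M \<and>
        (AE \<omega> in M. vec_cond_exp M (F k) (e k) \<omega> = 0) \<and>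
        (AE \<omega> in M. nn_cond_exp M (F k) (\<lambda>\<omega>. ennreal ((norm (e k \<omega>))\<^sup>2)) \<omega> \<le> ennreal (\<sigma>\<^sup>2)))"

end

theory Submission
  imports Defs
begin

text \<open>The proof separates a pathwise argument from the control of the noise.

  \<^bold>\<open>Pathwise.\<close> Write \<open>a k = \<alpha> k / (1 - lam)\<close>. The point
  \<open>z k = x k + (lam / (1 - lam)) * (x k - x (k - 1))\<close> moves by \<open>- a k\<close> times the stochastic
  gradient, without momentum. Let \<open>y\<close> be the exponential average of the errors,
  \<open>y (k + 1) = (1 - a k) * y k + a k * e k\<close>. Then \<open>w = z - y\<close> performs gradient descent with step size
  \<open>a k\<close>, and the gradient is perturbed only by multiples of the momentum \<open>x k - x (k - 1)\<close> and of
  \<open>y k\<close>. In this form \<open>f (w k)\<close>, plus a multiple of the squared momentum and of the remaining noise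
  \<open>u k\<close>, the sum of \<open>a j * (\<rho> j)\<^sup>2\<close> over \<open>j \<ge> k\<close> with \<open>\<rho> j\<close> of the size of \<open>y j\<close> and \<open>a j * e j\<close>,
  decreases in every late step by at least a constant times \<open>a k * (G k)\<^sup>2\<close>, where \<open>G k\<close> adds up the
  gradient, the momentum and the noise (\<open>V_decreases\<close>). If \<open>w\<close> does not diverge, it has an accumulation
  point. Near it the Lojasiewicz inequality converts this decrease into one of order \<open>a k * G k\<close>, which
  pays for the length of the step (\<open>desingularised_decrease\<close>). A sequence whose steps are paid for in
  this way cannot leave the neighbourhood again (\<open>trapped_near_accumulation_point\<close>), so it converges,
  and the limit is critical because the steps \<open>a k\<close> are not summable.

  \<^bold>\<open>Noise.\<close> The conversion works if \<open>a k * u k powr \<xi>\<close> is summable for some \<open>\<xi> < 1\<close>. With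
  \<open>S k\<close> the sum of the steps up to \<open>k\<close>, it suffices that \<open>a k * S k powr (2 * r) * (\<rho> k)\<^sup>2\<close> is summable:
  then \<open>u k\<close> is of order \<open>S k powr (- 2 * r)\<close>, and \<open>2 * r > 1\<close> leaves room for an exponent \<open>\<xi>\<close>
  slightly below one (\<open>weighted_tails_powr_summable\<close>). This is why the errors are averaged over a unit
  of time and not summed up to infinity: the tail sums of the noise would only be of order
  \<open>S k powr - r\<close>, and their squares, multiplied by \<open>a k\<close>, would have tails of the larger order
  \<open>S k powr (1 - 2 * r)\<close>. For the average, orthogonality of martingale differences gives a recursion
  for the second moments, from which the weighted sum is finite in expectation (\<open>weighted_averaging\<close>),
  and a maximal inequality of Kolmogorov type shows that \<open>y k\<close> tends to zero almost surely
  (\<open>damped_martingale.AE_tendsto_zero\<close>).\<close>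

section \<open>Smooth functions and the Lojasiewicz inequality\<close>

lemma descent_lemma:
  fixes f :: "'a::euclidean_space \<Rightarrow> real"
  assumes diff: "\<forall>z. f differentiable (at z)" and lip: "L-lipschitz_on UNIV (grad f)"
  shows "f y \<le> f x + grad f x \<bullet> (y - x) + L * (norm (y - x))\<^sup>2"
proof -
  define \<phi> where "\<phi> t = f (x + t *\<^sub>R (y - x))" for t
  have deriv: "(\<phi> has_derivative (\<lambda>h. (h *\<^sub>R (y - x)) \<bullet> grad f (x + t *\<^sub>R (y - x)))) (at t)" for t
  proof -
    have "(f has_derivative (\<lambda>h. h \<bullet> grad f (x + t *\<^sub>R (y - x)))) (at (x + t *\<^sub>R (y - x)))"
      using GDERIV_grad diff unfolding gderiv_def by blast
    moreover have "((\<lambda>t. x + t *\<^sub>R (y - x)) has_derivative (\<lambda>h. h *\<^sub>R (y - x))) (at t)"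
      by (auto intro!: derivative_eq_intros)
    ultimately show ?thesis
      unfolding \<phi>_def by (rule has_derivative_compose[rotated])
  qed
  have "continuous_on {0..1} \<phi>"
    by (meson deriv differentiable_imp_continuous_on differentiable_on_def
        differentiable_at_withinI differentiableI)
  then obtain t where t: "0 < t" "t < 1"
    and mv: "\<phi> 1 - \<phi> 0 = ((1 - 0) *\<^sub>R (y - x)) \<bullet> grad f (x + t *\<^sub>R (y - x))"
    using mvt[of 0 1 \<phi>, OF _ _ deriv] by auto
  define u where "u = grad f (x + t *\<^sub>R (y - x)) - grad f x"
  have L: "0 \<le> L" using lip by (rule lipschitz_on_nonneg)
  have "norm u \<le> L * norm (t *\<^sub>R (y - x))"
    using lipschitz_onD[OF lip, of "x + t *\<^sub>R (y - x)" x] by (simp add: u_def dist_norm)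
  also have "\<dots> \<le> L * norm (y - x)"
    using t L by (intro mult_left_mono) (auto simp: mult_left_le_one_le)
  finally have "u \<bullet> (y - x) \<le> L * norm (y - x) * norm (y - x)"
    by (meson norm_cauchy_schwarz order_trans mult_right_mono norm_ge_zero)
  moreover have "f y - f x = grad f x \<bullet> (y - x) + u \<bullet> (y - x)"
    using mv by (simp add: \<phi>_def u_def inner_commute algebra_simps)
  ultimately show ?thesis
    by (simp add: power2_eq_square mult.assoc)
qed

text \<open>At a noncritical point the inequality is trivial, because the gradient stays away from zero
  while the values of \<open>f\<close> vary little. Treating both kinds of points alike lets the convergence
  argument run at any accumulation point; that the limit is critical then comes out at the end.\<close>

lemma local_Lojasiewicz:
  fixes f :: "'a::euclidean_space \<Rightarrow> real"
  assumes diff: "\<forall>z. f differentiable (at z)" and cont: "continuous_on UNIV (grad f)"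
    and loj: "\<forall>z\<in>crit f. Lojasiewicz_at f z"
  obtains r C \<theta> where "0 < r" "0 \<le> C" "1/2 \<le> \<theta>" "\<theta> < 1"
    "\<And>x. x \<in> ball z r \<Longrightarrow> \<bar>f x - f z\<bar> \<le> 1"
    "\<And>x. x \<in> ball z r \<Longrightarrow> \<bar>f x - f z\<bar> powr \<theta> \<le> C * norm (grad f x)"
proof -
  have fc: "isCont f z" using diff differentiable_imp_continuous_within by blast
  have near: "\<exists>r>0. \<forall>x\<in>ball z r. \<bar>f x - f z\<bar> < \<epsilon>" if "0 < \<epsilon>" for \<epsilon>
    using fc that unfolding continuous_at_eps_delta
    by (metis dist_commute dist_real_def mem_ball)
  obtain r1 where r1: "0 < r1" "\<And>x. x \<in> ball z r1 \<Longrightarrow> \<bar>f x - f z\<bar> < 1"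
    using near[of 1] by auto
  show ?thesis
  proof (cases "z \<in> crit f")
    case True
    with loj obtain \<eta> :: ereal and U C \<theta> where U: "0 < \<eta>" "open U" "z \<in> U"
      and C: "0 < C" "\<theta> \<in> {1/2..<1}"
      and ineq: "\<And>x. x \<in> U \<Longrightarrow> 0 < \<bar>f x - f z\<bar> \<Longrightarrow> ereal \<bar>f x - f z\<bar> < \<eta> \<Longrightarrow>
        norm (grad f x) \<ge> C * \<bar>f x - f z\<bar> powr \<theta>"
      unfolding Lojasiewicz_at_def by blast
    obtain \<epsilon> where \<epsilon>: "0 < \<epsilon>" "ereal \<epsilon> < \<eta>"
      using U(1) ereal_dense2[of 0 \<eta>] by (auto simp: zero_ereal_def)
    obtain r2 where r2: "0 < r2" "\<And>x. x \<in> ball z r2 \<Longrightarrow> \<bar>f x - f z\<bar> < \<epsilon>"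
      using near[OF \<epsilon>(1)] by auto
    obtain r3 where r3: "0 < r3" "ball z r3 \<subseteq> U"
      using U open_contains_ball by blast
    define r where "r = min r1 (min r2 r3)"
    show ?thesis
    proof (rule that[of r "1/C" \<theta>])
      fix x assume x: "x \<in> ball z r"
      show "\<bar>f x - f z\<bar> \<le> 1" using r1(2)[of x] x by (auto simp: r_def)
      show "\<bar>f x - f z\<bar> powr \<theta> \<le> 1 / C * norm (grad f x)"
      proof (cases "f x = f z")
        case False
        have "\<bar>f x - f z\<bar> < \<epsilon>" using r2(2)[of x] x by (auto simp: r_def)
        then have "ereal \<bar>f x - f z\<bar> < \<eta>" using \<epsilon> by (metis ereal_less_eq(3) less_imp_le order_le_less_trans)
        moreover have "x \<in> U" using r3(2) x by (auto simp: r_def)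
        ultimately have "C * \<bar>f x - f z\<bar> powr \<theta> \<le> norm (grad f x)" using ineq False by simp
        then show ?thesis using C by (simp add: field_simps)
      qed (use C in auto)
    qed (use C r1(1) r2(1) r3(1) in \<open>auto simp: r_def\<close>)
  next
    case False
    define c where "c = norm (grad f z)"
    have c: "0 < c" using False by (simp add: c_def crit_def)
    have "isCont (grad f) z" using cont by (simp add: continuous_on_eq_continuous_at)
    then obtain r2 where r2: "0 < r2" "\<And>x. x \<in> ball z r2 \<Longrightarrow> dist (grad f x) (grad f z) < c / 2"
      unfolding continuous_at_eps_delta using c by (metis dist_commute half_gt_zero mem_ball)
    define r where "r = min r1 r2"
    show ?thesis
    proof (rule that[of r "2 / c" "1/2"])
      fix x assume x: "x \<in> ball z r"
      show 1: "\<bar>f x - f z\<bar> \<le> 1" using r1(2)[of x] x by (auto simp: r_def)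
      have "dist (grad f x) (grad f z) < c / 2" using r2(2)[of x] x by (auto simp: r_def)
      then have "c / 2 \<le> norm (grad f x)"
        unfolding c_def dist_norm using norm_triangle_ineq2[of "grad f z" "grad f x"]
        by (simp add: norm_minus_commute)
      then have "1 \<le> 2 / c * norm (grad f x)" using c by (simp add: field_simps)
      moreover have "\<bar>f x - f z\<bar> powr (1/2) \<le> 1" using 1 by (simp add: powr_half_sqrt)
      ultimately show "\<bar>f x - f z\<bar> powr (1/2) \<le> 2 / c * norm (grad f x)" by linarith
    qed (use c r1(1) r2(1) in \<open>auto simp: r_def\<close>)
  qed
qed

section \<open>Inequalities for powers and for sequences\<close>

lemma powr_tangent_inequality:
  fixes D b \<theta> :: real
  assumes "0 < D" "0 \<le> b" "0 < \<theta>" "\<theta> < 1"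
  shows "(1 - \<theta>) * (D - b) \<le> D powr \<theta> * (D powr (1 - \<theta>) - b powr (1 - \<theta>))"
proof (cases "b = 0")
  case True
  then show ?thesis using assms by (simp flip: powr_add) 
next
  case False
  then have b: "0 < b" using assms by simp
  have "b powr (1 - \<theta>) * D powr \<theta> \<le> (1 - \<theta>) * b + \<theta> * D"
    using Youngs_inequality_0[of "1 - \<theta>" \<theta> b D] assms b by simp
  moreover have "D powr \<theta> * D powr (1 - \<theta>) = D" using assms by (simp flip: powr_add)
  ultimately show ?thesis by (simp add: algebra_simps)
qed

lemma powr_subadditive:
  fixes x y \<theta> :: real
  assumes "0 \<le> x" "0 \<le> y" "0 < \<theta>" "\<theta> \<le> 1"
  shows "(x + y) powr \<theta> \<le> x powr \<theta> + y powr \<theta>"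
proof (cases "x + y = 0")
  case False
  then have p: "0 < x + y" using assms by simp
  have *: "t / (x + y) \<le> (t / (x + y)) powr \<theta>" if "0 \<le> t" "t \<le> x + y" for t
    using powr_mono'[of \<theta> 1 "t / (x + y)"] that p assms by simp
  have "1 = x / (x + y) + y / (x + y)" using p by (simp flip: add_divide_distrib)
  also have "\<dots> \<le> (x / (x + y)) powr \<theta> + (y / (x + y)) powr \<theta>"
    using *[of x] *[of y] assms by auto
  also have "\<dots> = (x powr \<theta> + y powr \<theta>) / (x + y) powr \<theta>"
    using assms p by (simp add: powr_divide add_divide_distrib)
  finally show ?thesis using p by (simp add: field_simps)
qed (use assms in auto)

text \<open>The desingularising function \<open>t \<mapsto> t powr (1 - \<theta>)\<close> turns a decrease of order \<open>G\<^sup>2\<close> into a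
  decrease of order \<open>G\<close>: by concavity the gain is at least a multiple of \<open>G\<^sup>2 / D powr \<theta>\<close>. The
  error \<open>v\<close> in the gradient inequality only matters when it exceeds \<open>G\<close>, and then it bounds \<open>G\<close>
  itself.\<close>

lemma desingularised_decrease:
  fixes D b G v c C a \<theta> :: real
  assumes "0 \<le> b" "0 \<le> D" "0 < \<theta>" "\<theta> < 1" "0 \<le> G" "0 \<le> v" "0 \<le> C" "0 < c" "0 < a"
    and KL: "D powr \<theta> \<le> C * G + v" and dec: "c * a * G\<^sup>2 \<le> D - b"
  shows "a * G \<le> (C + 1) / (c * (1 - \<theta>)) * (D powr (1 - \<theta>) - b powr (1 - \<theta>)) + a * v"
proof -
  have "b \<le> D" using dec assms by (smt (verit) mult_nonneg_nonneg zero_le_power2)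
  then have mono: "b powr (1 - \<theta>) \<le> D powr (1 - \<theta>)" using assms by (intro powr_mono2) auto
  then have first: "0 \<le> (C + 1) / (c * (1 - \<theta>)) * (D powr (1 - \<theta>) - b powr (1 - \<theta>))"
    using assms by auto
  show ?thesis
  proof (cases "G \<le> v")
    case True
    then show ?thesis using first assms mult_left_mono[of G v a] by linarith
  next
    case False
    then have G: "0 < G" using assms by simp
    have "0 < c * a * G\<^sup>2" using assms G by simp
    then have D: "0 < D" using dec assms by linarith
    define \<Delta> where "\<Delta> = D powr (1 - \<theta>) - b powr (1 - \<theta>)"
    have "(1 - \<theta>) * (c * a * G\<^sup>2) \<le> (1 - \<theta>) * (D - b)"
      using dec assms by (intro mult_left_mono) auto
    also have "\<dots> \<le> D powr \<theta> * \<Delta>"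
      unfolding \<Delta>_def by (rule powr_tangent_inequality) (use D assms in auto)
    also have "\<dots> \<le> ((C + 1) * G) * \<Delta>"
      using KL False mono by (intro mult_right_mono) (auto simp: \<Delta>_def algebra_simps)
    finally have "G * ((1 - \<theta>) * c * (a * G)) \<le> G * ((C + 1) * \<Delta>)"
      by (simp add: power2_eq_square algebra_simps)
    then have "(1 - \<theta>) * c * (a * G) \<le> (C + 1) * \<Delta>" using G by simp
    then have "a * G \<le> (C + 1) / (c * (1 - \<theta>)) * \<Delta>"
      using assms by (simp add: field_simps)
    then show ?thesis using assms unfolding \<Delta>_def by (smt (verit) mult_nonneg_nonneg)
  qed
qed

lemma contraction_tendsto_zero:
  fixes x y :: "nat \<Rightarrow> real"
  assumes "\<And>k. 0 \<le> x k" "0 \<le> \<mu>" "\<mu> < 1" "y \<longlonglongrightarrow> 0"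
    and step: "\<And>k. x (Suc k) \<le> \<mu> * x k + y k"
  shows "x \<longlonglongrightarrow> 0"
proof (rule LIMSEQ_I)
  fix \<epsilon> :: real assume \<epsilon>: "0 < \<epsilon>"
  then have e: "0 < \<epsilon> / 2 * (1 - \<mu>)" using assms by simp
  obtain N where N: "\<And>k. k \<ge> N \<Longrightarrow> y k \<le> \<epsilon> / 2 * (1 - \<mu>)"
    using LIMSEQ_D[OF assms(4) e] by (force simp: abs_less_iff)
  have bound: "x (N + n) \<le> \<mu> ^ n * x N + \<epsilon> / 2" for n
  proof (induction n)
    case (Suc n)
    have "x (N + Suc n) \<le> \<mu> * x (N + n) + y (N + n)" using step[of "N + n"] by simp
    also have "\<dots> \<le> \<mu> * (\<mu> ^ n * x N + \<epsilon> / 2) + \<epsilon> / 2 * (1 - \<mu>)"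
      using Suc N assms by (intro add_mono mult_left_mono) auto
    finally show ?case by (simp add: field_simps)
  qed (use \<epsilon> in simp)
  have "(\<lambda>n. \<mu> ^ n * x N) \<longlonglongrightarrow> 0 * x N"
    using assms by (intro tendsto_intros LIMSEQ_power_zero) auto
  then obtain m where m: "\<And>n. n \<ge> m \<Longrightarrow> \<mu> ^ n * x N < \<epsilon> / 2"
    using LIMSEQ_D[of _ 0 "\<epsilon> / 2"] \<epsilon> by (force simp: abs_less_iff)
  show "\<exists>no. \<forall>n\<ge>no. norm (x n - 0) < \<epsilon>"
  proof (intro exI allI impI)
    fix n assume n: "n \<ge> N + m"
    have "x n \<le> \<mu> ^ (n - N) * x N + \<epsilon> / 2" using bound[of "n - N"] n by simp
    moreover have "m \<le> n - N" using n by simp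
    ultimately show "norm (x n - 0) < \<epsilon>" using m[of "n - N"] assms(1)[of n] by simp
  qed
qed

text \<open>If a sequence comes arbitrarily close to a point, and if close to that point the length of a
  step is paid for by the decrease of a potential that tends to zero, then the sequence is trapped:
  once it is very close with little potential left, it cannot afford to leave.\<close>

lemma trapped_near_accumulation_point:
  fixes w :: "nat \<Rightarrow> 'a::real_normed_vector"
  assumes R: "0 < R"
    and near: "\<And>\<epsilon> N. 0 < \<epsilon> \<Longrightarrow> \<exists>k\<ge>N. dist z (w k) < \<epsilon>"
    and step: "\<And>k. k \<ge> N0 \<Longrightarrow> w k \<in> ball z R \<Longrightarrow>
      norm (w (Suc k) - w k) \<le> P k - P (Suc k) + t k"
    and P: "\<And>k. 0 \<le> P k" "P \<longlonglongrightarrow> 0" and t: "\<And>k. 0 \<le> t k" "summable t"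
  shows "w \<longlonglongrightarrow> z"
proof (rule metric_LIMSEQ_I)
  fix \<epsilon> :: real assume "0 < \<epsilon>"
  define \<rho> where "\<rho> = min \<epsilon> R / 3"
  have \<rho>: "0 < \<rho>" using \<open>0 < \<epsilon>\<close> R by (simp add: \<rho>_def)
  obtain N1 where N1: "\<And>k. k \<ge> N1 \<Longrightarrow> P k < \<rho>"
    using LIMSEQ_D[OF P(2) \<rho>] by (force simp: abs_less_iff)
  obtain N2 where N2: "\<And>m n. m \<ge> N2 \<Longrightarrow> norm (sum t {m..<n}) < \<rho>"
    using t(2) \<rho> unfolding summable_Cauchy by blast
  obtain K where K: "K \<ge> N0 + N1 + N2" "dist z (w K) < \<rho>" using near[OF \<rho>] by blast
  have *: "norm (w (K + n) - w K) \<le> P K - P (K + n) + sum t {K..<K + n}" for n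
  proof (induction n)
    case (Suc n)
    have "sum t {K..<K + n} < \<rho>" using N2[of K "K + n"] K by (auto simp: abs_less_iff)
    then have "norm (w (K + n) - w K) < 2 * \<rho>"
      using Suc N1[of K] K P(1)[of "K + n"] by simp
    then have "dist (w K) (w (K + n)) < 2 * \<rho>" by (simp add: dist_norm norm_minus_commute)
    then have "dist z (w (K + n)) < 3 * \<rho>"
      using K dist_triangle[of z "w (K + n)" "w K"] by simp
    then have "w (K + n) \<in> ball z R" by (simp add: \<rho>_def)
    then have "norm (w (Suc (K + n)) - w (K + n)) \<le> P (K + n) - P (Suc (K + n)) + t (K + n)"
      using K by (intro step) auto
    moreover have "norm (w (K + Suc n) - w K) \<le>
        norm (w (Suc (K + n)) - w (K + n)) + norm (w (K + n) - w K)"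
      using norm_triangle_ineq[of "w (Suc (K + n)) - w (K + n)" "w (K + n) - w K"] by simp
    ultimately show ?case using Suc by simp
  qed simp
  show "\<exists>no. \<forall>n\<ge>no. dist (w n) z < \<epsilon>"
  proof (intro exI allI impI)
    fix n assume n: "n \<ge> K"
    have "sum t {K..<n} < \<rho>" using N2[of K n] K by (auto simp: abs_less_iff)
    then have "norm (w n - w K) < 2 * \<rho>"
      using *[of "n - K"] n N1[of K] K P(1)[of n] by simp
    then have "dist (w n) (w K) < 2 * \<rho>" by (simp add: dist_norm)
    then have "dist (w n) z < 3 * \<rho>"
      using K dist_triangle[of "w n" z "w K"] by (simp add: dist_commute)
    then show "dist (w n) z < \<epsilon>" by (simp add: \<rho>_def)
  qed
qed

lemma accumulation_point_if_not_diverging: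
  fixes w :: "nat \<Rightarrow> 'a::euclidean_space"
  assumes "\<not> filterlim (\<lambda>k. norm (w k)) at_top sequentially"
  obtains z s where "strict_mono (s :: nat \<Rightarrow> nat)" "(w \<circ> s) \<longlonglongrightarrow> z"
proof -
  obtain B where "\<not> eventually (\<lambda>k. B \<le> norm (w k)) sequentially"
    using assms unfolding filterlim_at_top by blast
  then have "\<exists>\<^sub>F k in sequentially. norm (w k) \<le> B"
    unfolding frequently_def by (metis (mono_tags, lifting) eventually_mono nle_le)
  then have inf: "infinite {k. norm (w k) \<le> B}"
    by (simp add: frequently_cofinite flip: cofinite_eq_sequentially)
  define s0 where "s0 = enumerate {k. norm (w k) \<le> B}"
  have s0: "strict_mono s0" using inf by (simp add: s0_def strict_mono_enumerate)
  have "\<forall>n. (w \<circ> s0) n \<in> cball 0 B"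
    using enumerate_in_set[OF inf] by (simp add: s0_def)
  then obtain z s1 where "strict_mono s1" "((w \<circ> s0) \<circ> s1) \<longlonglongrightarrow> z"
    using compact_cball[of "0::'a" B] unfolding compact_def by metis
  then show ?thesis using that[of "s0 \<circ> s1" z] s0 by (simp add: strict_mono_o comp_assoc)
qed

section \<open>Gradient descent with perturbations and momentum\<close>

lemma square_sum_le: "((x::real) + y)\<^sup>2 \<le> 2 * x\<^sup>2 + 2 * y\<^sup>2"
  using zero_le_power2[of "x - y"] by (simp add: power2_eq_square algebra_simps)

text \<open>Convexity of the square, applied to \<open>\<mu> * x + (1 - \<mu>) * (y / (1 - \<mu>))\<close>.\<close>

lemma square_contraction:
  fixes x y \<mu> :: real
  assumes "0 \<le> \<mu>" "\<mu> < 1"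
  shows "(\<mu> * x + y)\<^sup>2 \<le> \<mu> * x\<^sup>2 + y\<^sup>2 / (1 - \<mu>)"
proof -
  have "0 \<le> \<mu> * ((1 - \<mu>) * x - y)\<^sup>2" using assms by simp
  also have "\<dots> = (1 - \<mu>) * (\<mu> * x\<^sup>2 + y\<^sup>2 / (1 - \<mu>) - (\<mu> * x + y)\<^sup>2)"
    using assms by (simp add: power2_eq_square divide_simps) (simp add: algebra_simps)
  finally show ?thesis using assms by (simp add: zero_le_mult_iff)
qed

lemma perturbed_gradient_step_decrease:
  fixes f :: "'a::euclidean_space \<Rightarrow> real"
  assumes diff: "\<forall>z. f differentiable (at z)" and lip: "L-lipschitz_on UNIV (grad f)"
    and a: "0 < a" "L * a \<le> 1/8"
    and step: "norm (y - x + a *\<^sub>R grad f x) \<le> a * P"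
  shows "f y \<le> f x - a / 2 * (norm (grad f x))\<^sup>2 + 2 * a * P\<^sup>2"
proof -
  define e where "e = y - x + a *\<^sub>R grad f x"
  define g where "g = norm (grad f x)"
  have L: "0 \<le> L" using lip by (rule lipschitz_on_nonneg)
  have e: "norm e \<le> a * P" using step by (simp add: e_def)
  have P: "0 \<le> P" using e a by (smt (verit) norm_ge_zero zero_le_mult_iff)
  have yx: "y - x = e - a *\<^sub>R grad f x" by (simp add: e_def)
  have "grad f x \<bullet> (y - x) = grad f x \<bullet> e - a * g\<^sup>2"
    by (simp add: yx inner_diff_right g_def dot_square_norm)
  also have "grad f x \<bullet> e \<le> g * (a * P)"
    unfolding g_def using e by (meson norm_cauchy_schwarz mult_left_mono norm_ge_zero order_trans)
  finally have 1: "grad f x \<bullet> (y - x) \<le> a * (g * P) - a * g\<^sup>2" by (simp add: ac_simps)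
  have "norm (y - x) \<le> a * P + a * g"
    using norm_triangle_ineq4[of e "a *\<^sub>R grad f x"] e a by (simp add: yx g_def)
  then have "(norm (y - x))\<^sup>2 \<le> (a * P + a * g)\<^sup>2" by (intro power_mono) auto
  also have "\<dots> \<le> 2 * (a * P)\<^sup>2 + 2 * (a * g)\<^sup>2" by (rule square_sum_le)
  also have "\<dots> = a * (a * (2 * P\<^sup>2 + 2 * g\<^sup>2))" by (simp add: power2_eq_square algebra_simps)
  finally have "L * (norm (y - x))\<^sup>2 \<le> L * (a * (a * (2 * P\<^sup>2 + 2 * g\<^sup>2)))"
    using L by (rule mult_left_mono)
  also have "\<dots> = (L * a) * (a * (2 * P\<^sup>2 + 2 * g\<^sup>2))" by simp
  also have "\<dots> \<le> 1/8 * (a * (2 * P\<^sup>2 + 2 * g\<^sup>2))"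
    using a by (intro mult_right_mono) auto
  finally have 2: "L * (norm (y - x))\<^sup>2 \<le> a * P\<^sup>2 / 4 + a * g\<^sup>2 / 4" by (simp add: algebra_simps)
  have "a * (g * P) \<le> a * (g\<^sup>2 / 4 + P\<^sup>2)"
    using zero_le_power2[of "g / 2 - P"] a
    by (intro mult_left_mono) (auto simp: power2_eq_square algebra_simps)
  then have 3: "a * (g * P) \<le> a * g\<^sup>2 / 4 + a * P\<^sup>2" by (simp add: algebra_simps)
  have "0 \<le> a * P\<^sup>2" using a by simp
  then show ?thesis
    using descent_lemma[OF diff lip, of y x] 1 2 3 unfolding g_def[symmetric] by simp
qed

text \<open>The pathwise setting. The points \<open>w k\<close> follow gradient descent up to an error controlled by the
  momentum \<open>\<delta> k\<close> and the noise \<open>\<rho> k\<close>. The momentum is contracted by the factor \<open>\<mu>\<close> and fed by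
  the gradient and the noise. The squared noise is summable against the step sizes, and its tails decay fast
  enough for a power \<open>\<xi> < 1\<close> of them to remain summable.\<close>

locale perturbed_descent =
  fixes f :: "'a::euclidean_space \<Rightarrow> real" and L C \<mu> \<xi> :: real
    and a \<rho> \<delta> :: "nat \<Rightarrow> real" and w :: "nat \<Rightarrow> 'a"
  assumes diff: "\<forall>z. f differentiable (at z)" and lip: "L-lipschitz_on UNIV (grad f)"
    and bdd: "bdd_below (range f)" and loj: "\<forall>z\<in>crit f. Lojasiewicz_at f z"
    and mu: "0 \<le> \<mu>" "\<mu> < 1" and xi: "0 < \<xi>" "\<xi> < 1"
    and a_pos: "\<And>k. 0 < a k" and a_decreasing: "\<And>k. a (Suc k) \<le> a k"
    and a_lim: "a \<longlonglongrightarrow> 0" and a_divergent: "\<not> summable a"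
    and rho_nonneg: "\<And>k. 0 \<le> \<rho> k" and rho_lim: "\<rho> \<longlonglongrightarrow> 0"
    and rho_summable: "summable (\<lambda>k. a k * (\<rho> k)\<^sup>2)"
    and tail_summable: "summable (\<lambda>k. a k * (\<Sum>j. a (j + k) * (\<rho> (j + k))\<^sup>2) powr \<xi>)"
    and delta_nonneg: "\<And>k. 0 \<le> \<delta> k"
    and step_w: "\<And>k. norm (w (Suc k) - w k + a k *\<^sub>R grad f (w k)) \<le> a k * (C * (\<delta> k + \<rho> k))"
    and step_delta: "\<And>k. \<delta> (Suc k) \<le> \<mu> * \<delta> k + (a k * norm (grad f (w k)) + \<rho> k)"
begin

text \<open>\<open>K\<close> and \<open>A\<close> are the weights of the momentum and of the noise in the Lyapunov function \<open>V\<close>. A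
  gradient step may raise \<open>f\<close> by \<open>4 * C\<^sup>2 * a k\<close> times the squares of \<open>\<delta> k\<close> and \<open>\<rho> k\<close>. The
  contraction of the momentum gains \<open>K * (1 - \<mu>)\<close> times \<open>a k * (\<delta> k)\<^sup>2\<close>, and the loss of one term of the
  tail \<open>u k\<close> gains \<open>A * a k * (\<rho> k)\<^sup>2\<close>; both exceed what is needed by \<open>1/4\<close>, so that squared momentum
  and noise appear in the decrease of \<open>V\<close> like the squared gradient.\<close>

definition K :: real where "K = (4 * C\<^sup>2 + 1/4) / (1 - \<mu>)"
definition A :: real where "A = 4 * C\<^sup>2 + K * (2 / (1 - \<mu>)) + 1/4"
definition u :: "nat \<Rightarrow> real" where "u k = (\<Sum>j. a (j + k) * (\<rho> (j + k))\<^sup>2)"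
definition V :: "nat \<Rightarrow> real" where "V k = f (w k) + K * (a k * (\<delta> k)\<^sup>2) + A * u k"

text \<open>\<open>G\<close> controls both the decrease of \<open>V\<close>, quadratically, and the length of a step, linearly.\<close>

definition G :: "nat \<Rightarrow> real" where "G k = norm (grad f (w k)) + \<delta> k + \<rho> k"

lemma K_nonneg: "0 \<le> K" and A_nonneg: "0 \<le> A"
  using mu by (auto simp: K_def A_def)

lemma G_nonneg: "0 \<le> G k"
  by (simp add: G_def delta_nonneg rho_nonneg)

lemma u_step: "u k = a k * (\<rho> k)\<^sup>2 + u (Suc k)"
  using suminf_split_head[of "\<lambda>j. a (j + k) * (\<rho> (j + k))\<^sup>2"] rho_summable
  by (simp add: u_def summable_iff_shift[of "\<lambda>k. a k * (\<rho> k)\<^sup>2"])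

lemma u_nonneg: "0 \<le> u k"
  unfolding u_def using rho_summable a_pos
  by (intro suminf_nonneg) (auto simp: summable_iff_shift[of "\<lambda>k. a k * (\<rho> k)\<^sup>2"] less_imp_le)

lemma u_lim: "u \<longlonglongrightarrow> 0"
proof -
  have "(\<lambda>k. suminf (\<lambda>k. a k * (\<rho> k)\<^sup>2) - sum (\<lambda>k. a k * (\<rho> k)\<^sup>2) {..<k}) \<longlonglongrightarrow> 0"
    using tendsto_diff[OF tendsto_const[of "suminf (\<lambda>k. a k * (\<rho> k)\<^sup>2)"] summable_LIMSEQ[OF rho_summable]]
    by simp
  then show ?thesis
    unfolding u_def using suminf_minus_initial_segment[OF rho_summable] by simp
qed

lemma V_decreases: "\<forall>\<^sub>F k in sequentially. V (Suc k) \<le> V k - 1/12 * a k * (G k)\<^sup>2"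
proof -
  define M where "M = 2 / (1 - \<mu>)"
  have M: "0 \<le> M" using mu by (simp add: M_def)
  have "(\<lambda>k. L * a k) \<longlonglongrightarrow> L * 0" "(\<lambda>k. K * M * (a k)\<^sup>2) \<longlonglongrightarrow> K * M * 0\<^sup>2"
    by (intro tendsto_intros a_lim)+
  then have "\<forall>\<^sub>F k in sequentially. L * a k < 1/8" "\<forall>\<^sub>F k in sequentially. K * M * (a k)\<^sup>2 < 1/4"
    using order_tendstoD(2)[where y = "0::real" and a = "1/8" and F = sequentially]
      order_tendstoD(2)[where y = "0::real" and a = "1/4" and F = sequentially]
    by simp_all
  then show ?thesis
  proof eventually_elim
    case (elim k)
    define g where "g = norm (grad f (w k))"
    have a: "0 < a k" "a (Suc k) \<le> a k" by (rule a_pos a_decreasing)+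
    have "f (w (Suc k)) \<le> f (w k) - a k / 2 * g\<^sup>2 + 2 * a k * (C * (\<delta> k + \<rho> k))\<^sup>2"
      unfolding g_def using perturbed_gradient_step_decrease[OF diff lip a(1) _ step_w] elim by simp
    moreover have "a k * (C * (\<delta> k + \<rho> k))\<^sup>2 \<le> a k * (C\<^sup>2 * (2 * (\<delta> k)\<^sup>2 + 2 * (\<rho> k)\<^sup>2))"
      using a square_sum_le by (intro mult_left_mono) (auto simp: power_mult_distrib mult_left_mono)
    ultimately have 1: "f (w (Suc k)) \<le> f (w k) - a k / 2 * g\<^sup>2
        + 4 * C\<^sup>2 * (a k * (\<delta> k)\<^sup>2) + 4 * C\<^sup>2 * (a k * (\<rho> k)\<^sup>2)"
      by (simp add: algebra_simps)
    have "(\<delta> (Suc k))\<^sup>2 \<le> (\<mu> * \<delta> k + (a k * g + \<rho> k))\<^sup>2"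
      unfolding g_def by (intro power_mono step_delta delta_nonneg)
    also have "\<dots> \<le> \<mu> * (\<delta> k)\<^sup>2 + (a k * g + \<rho> k)\<^sup>2 / (1 - \<mu>)"
      by (rule square_contraction) (use mu in auto)
    also have "(a k * g + \<rho> k)\<^sup>2 / (1 - \<mu>) \<le> (2 * (a k * g)\<^sup>2 + 2 * (\<rho> k)\<^sup>2) / (1 - \<mu>)"
      using mu square_sum_le by (intro divide_right_mono) auto
    also have "\<dots> = M * (a k)\<^sup>2 * g\<^sup>2 + M * (\<rho> k)\<^sup>2"
      by (simp add: M_def power_mult_distrib add_divide_distrib)
    finally have "(\<delta> (Suc k))\<^sup>2 \<le> \<mu> * (\<delta> k)\<^sup>2 + (M * (a k)\<^sup>2 * g\<^sup>2 + M * (\<rho> k)\<^sup>2)" by simp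
    then have "K * (a (Suc k) * (\<delta> (Suc k))\<^sup>2)
        \<le> K * (a k * (\<mu> * (\<delta> k)\<^sup>2 + (M * (a k)\<^sup>2 * g\<^sup>2 + M * (\<rho> k)\<^sup>2)))"
      using a K_nonneg by (intro mult_left_mono mult_mono) auto
    also have "\<dots> = K * \<mu> * (a k * (\<delta> k)\<^sup>2) + (K * M * (a k)\<^sup>2) * (a k * g\<^sup>2)
        + K * M * (a k * (\<rho> k)\<^sup>2)"
      by (simp add: algebra_simps)
    also have "(K * M * (a k)\<^sup>2) * (a k * g\<^sup>2) \<le> 1/4 * (a k * g\<^sup>2)"
      using elim a by (intro mult_right_mono) auto
    finally have 2: "K * (a (Suc k) * (\<delta> (Suc k))\<^sup>2)
        \<le> K * \<mu> * (a k * (\<delta> k)\<^sup>2) + 1/4 * (a k * g\<^sup>2) + K * M * (a k * (\<rho> k)\<^sup>2)"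
      by simp
    have "K - K * \<mu> = K * (1 - \<mu>)" by (simp add: algebra_simps)
    also have "\<dots> = 4 * C\<^sup>2 + 1/4" using mu by (simp add: K_def)
    finally have "K - K * \<mu> = 4 * C\<^sup>2 + 1/4" .
    then have 3: "K * \<mu> * (a k * (\<delta> k)\<^sup>2)
        = K * (a k * (\<delta> k)\<^sup>2) - 4 * C\<^sup>2 * (a k * (\<delta> k)\<^sup>2) - 1/4 * (a k * (\<delta> k)\<^sup>2)"
      by (smt (verit) left_diff_distrib distrib_right)
    have 4: "A * u (Suc k) = A * u k - 4 * C\<^sup>2 * (a k * (\<rho> k)\<^sup>2) - K * M * (a k * (\<rho> k)\<^sup>2)
        - 1/4 * (a k * (\<rho> k)\<^sup>2)"
      using u_step[of k] by (simp add: A_def M_def[symmetric] algebra_simps)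
    have "V (Suc k) \<le> V k - 1/4 * (a k * (g\<^sup>2 + (\<delta> k)\<^sup>2 + (\<rho> k)\<^sup>2))"
      using 1 2 3 4 unfolding V_def by (simp add: algebra_simps)
    moreover have "(G k)\<^sup>2 \<le> 3 * (g\<^sup>2 + (\<delta> k)\<^sup>2 + (\<rho> k)\<^sup>2)"
      using zero_le_power2[of "g - \<delta> k"] zero_le_power2[of "g - \<rho> k"]
        zero_le_power2[of "\<delta> k - \<rho> k"]
      unfolding G_def g_def[symmetric] by (simp add: power2_eq_square algebra_simps)
    then have "a k * (G k)\<^sup>2 \<le> 3 * (a k * (g\<^sup>2 + (\<delta> k)\<^sup>2 + (\<rho> k)\<^sup>2))"
      using a mult_left_mono[of "(G k)\<^sup>2" _ "a k"] by (simp add: ac_simps)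
    ultimately show ?case by simp
  qed
qed

lemma V_bounded_below: obtains B where "\<And>k. B \<le> V k"
proof -
  obtain B where "\<And>z. B \<le> f z" using bdd unfolding bdd_below_def by blast
  then have "B \<le> V k" for k
    using K_nonneg A_nonneg u_nonneg[of k] a_pos[of k]
    by (simp add: V_def add_increasing2 less_imp_le)
  then show ?thesis by (rule that)
qed

lemma V_convergent_and_decrease_summable:
  obtains Vlim where "V \<longlonglongrightarrow> Vlim" "\<forall>\<^sub>F k in sequentially. Vlim \<le> V k"
    "summable (\<lambda>k. a k * (G k)\<^sup>2)"
proof -
  obtain N where N: "\<And>k. k \<ge> N \<Longrightarrow> V (Suc k) \<le> V k - 1/12 * a k * (G k)\<^sup>2"
    using V_decreases by (auto simp: eventually_sequentially)
  obtain B where B: "\<And>k. B \<le> V k" using V_bounded_below by blast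
  have nonneg: "0 \<le> 1/12 * a k * (G k)\<^sup>2" for k using a_pos[of k] by simp
  have dec: "decseq (\<lambda>k. V (k + N))"
    using N nonneg by (intro decseq_SucI) (smt (verit) add_Suc le_add2)
  then obtain Vlim where Vlim: "(\<lambda>k. V (k + N)) \<longlonglongrightarrow> Vlim" "\<And>k. Vlim \<le> V (k + N)"
    using decseq_convergent[of "\<lambda>k. V (k + N)" B] B by auto
  have 1: "V \<longlonglongrightarrow> Vlim" using Vlim(1) by (rule LIMSEQ_offset)
  have "Vlim \<le> V k" if "k \<ge> N" for k using Vlim(2)[of "k - N"] that by simp
  then have 2: "\<forall>\<^sub>F k in sequentially. Vlim \<le> V k" by (auto simp: eventually_sequentially)
  have "(\<Sum>i<n. 1/12 * a (i + N) * (G (i + N))\<^sup>2) \<le> V N - B" for n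
  proof -
    have "(\<Sum>i<n. 1/12 * a (i + N) * (G (i + N))\<^sup>2) \<le> (\<Sum>i<n. V (i + N) - V (Suc i + N))"
      using N by (intro sum_mono) (smt (verit) add_Suc le_add2)
    also have "\<dots> = V N - V (n + N)"
      using sum_lessThan_telescope'[of "\<lambda>i. V (i + N)" n] by simp
    finally show ?thesis using B[of "n + N"] by simp
  qed
  then have "summable (\<lambda>k. 1/12 * a (k + N) * (G (k + N))\<^sup>2)"
    by (intro summableI_nonneg_bounded nonneg)
  then have "summable (\<lambda>k. 1/12 * (a (k + N) * (G (k + N))\<^sup>2))" by (simp add: mult.assoc)
  then have "summable (\<lambda>k. a (k + N) * (G (k + N))\<^sup>2)" by (simp only: summable_cmult_iff) simp
  then have "summable (\<lambda>k. a k * (G k)\<^sup>2)"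
    by (simp add: summable_iff_shift[of "\<lambda>k. a k * (G k)\<^sup>2"])
  then show ?thesis using 1 2 that by blast
qed

lemma norm_grad_le_G: "norm (grad f (w k)) \<le> G k"
  by (simp add: G_def delta_nonneg rho_nonneg)

lemma delta_lim: "\<delta> \<longlonglongrightarrow> 0"
proof -
  obtain Vlim where sum: "summable (\<lambda>k. a k * (G k)\<^sup>2)"
    using V_convergent_and_decrease_summable by blast
  have "(\<lambda>k. a k * (a k * (G k)\<^sup>2)) \<longlonglongrightarrow> 0 * 0"
    by (intro tendsto_mult a_lim summable_LIMSEQ_zero[OF sum])
  then have "(\<lambda>k. sqrt ((a k * G k)\<^sup>2)) \<longlonglongrightarrow> sqrt 0"
    by (intro tendsto_real_sqrt) (simp add: power2_eq_square ac_simps)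
  then have aG: "(\<lambda>k. a k * G k) \<longlonglongrightarrow> 0"
    using a_pos G_nonneg by (simp add: less_imp_le)
  have "(\<lambda>k. a k * norm (grad f (w k))) \<longlonglongrightarrow> 0"
    by (rule tendsto_sandwich[OF _ _ tendsto_const aG])
      (auto intro!: always_eventually mult_left_mono simp: norm_grad_le_G a_pos less_imp_le)
  then have "(\<lambda>k. a k * norm (grad f (w k)) + \<rho> k) \<longlonglongrightarrow> 0 + 0"
    by (intro tendsto_add rho_lim)
  then show ?thesis
    by (intro contraction_tendsto_zero[of \<delta> \<mu>, OF delta_nonneg mu _ step_delta]) simp
qed

lemma momentum_energy_lim: "(\<lambda>k. K * (a k * (\<delta> k)\<^sup>2)) \<longlonglongrightarrow> 0"
proof -
  have "(\<lambda>k. K * (a k * (\<delta> k)\<^sup>2)) \<longlonglongrightarrow> K * (0 * 0\<^sup>2)"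
    by (intro tendsto_intros a_lim delta_lim)
  then show ?thesis by simp
qed

lemma step_length_le: "norm (w (Suc k) - w k) \<le> (1 + \<bar>C\<bar>) * (a k * G k)"
proof -
  have "norm (w (Suc k) - w k) \<le> norm (w (Suc k) - w k + a k *\<^sub>R grad f (w k))
      + norm (a k *\<^sub>R grad f (w k))"
    using norm_triangle_ineq4[of "w (Suc k) - w k + a k *\<^sub>R grad f (w k)" "a k *\<^sub>R grad f (w k)"]
    by simp
  also have "\<dots> \<le> a k * (C * (\<delta> k + \<rho> k)) + a k * norm (grad f (w k))"
    using step_w[of k] a_pos[of k] by simp
  also have "\<dots> \<le> a k * (\<bar>C\<bar> * G k) + a k * G k"
    using a_pos[of k] delta_nonneg[of k] rho_nonneg[of k] norm_grad_le_G[of k]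
    by (intro add_mono mult_left_mono mult_mono) (auto simp: G_def)
  finally show ?thesis by (simp add: algebra_simps)
qed

text \<open>The excess \<open>V k - Vlim\<close> consists of a difference of values of \<open>f\<close>, the momentum energy, and the
  future noise. Raised to a power \<open>\<theta> \<ge> 1/2\<close>, the first is bounded by the gradient and the second
  by \<open>\<delta> k\<close>. For the third the exponent has to be at least \<open>\<xi>\<close>; increasing the Lojasiewicz
  exponent to \<open>max \<theta> \<xi>\<close> costs nothing near the point.\<close>

lemma excess_powr_le:
  assumes \<theta>: "1/2 \<le> \<theta>" "\<theta> < 1" "\<theta> \<le> \<theta>'" "\<xi> \<le> \<theta>'" "\<theta>' < 1"
    and D: "0 \<le> V k - c" and loj_w: "\<bar>f (w k) - c\<bar> \<le> 1"
      "\<bar>f (w k) - c\<bar> powr \<theta> \<le> B * norm (grad f (w k))" and B: "0 \<le> B"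
    and small: "\<delta> k \<le> 1" "K * a k \<le> 1" "A * u k \<le> 1"
  shows "(V k - c) powr \<theta>' \<le> (B + 1) * G k + (A * u k) powr \<xi>"
proof -
  define x y z where "x = \<bar>f (w k) - c\<bar>" and "y = K * (a k * (\<delta> k)\<^sup>2)" and "z = A * u k"
  have nonneg: "0 \<le> x" "0 \<le> y" "0 \<le> z"
    using K_nonneg A_nonneg a_pos[of k] u_nonneg[of k] by (auto simp: x_def y_def z_def)
  have "V k - c \<le> x + (y + z)" by (simp add: V_def x_def y_def z_def)
  then have "(V k - c) powr \<theta>' \<le> (x + (y + z)) powr \<theta>'"
    using D \<theta> by (intro powr_mono2) auto
  also have "\<dots> \<le> x powr \<theta>' + (y powr \<theta>' + z powr \<theta>')"
    using powr_subadditive[of x "y + z" \<theta>'] powr_subadditive[of y z \<theta>'] nonneg \<theta> by simp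
  finally have "(V k - c) powr \<theta>' \<le> x powr \<theta>' + (y powr \<theta>' + z powr \<theta>')" .
  moreover have "x powr \<theta>' \<le> x powr \<theta>"
    using nonneg loj_w(1) \<theta> by (intro powr_mono') (auto simp: x_def)
  moreover have "x powr \<theta> \<le> B * G k"
    using loj_w(2) mult_left_mono[OF norm_grad_le_G[of k] B] by (simp add: x_def)
  moreover have "y powr \<theta>' \<le> G k"
  proof -
    have "y = (K * a k) * (\<delta> k)\<^sup>2" by (simp add: y_def)
    also have "\<dots> \<le> 1 * (\<delta> k)\<^sup>2" using small by (intro mult_right_mono) auto
    finally have y: "y \<le> (\<delta> k)\<^sup>2" by simp
    have y1: "(\<delta> k)\<^sup>2 \<le> 1" using small delta_nonneg[of k] by (simp add: power_le_one)
    have "y powr \<theta>' \<le> ((\<delta> k)\<^sup>2) powr \<theta>'" using y nonneg \<theta> by (intro powr_mono2) auto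
    also have "\<dots> \<le> ((\<delta> k)\<^sup>2) powr (1/2)" using y1 \<theta> by (intro powr_mono') auto
    also have "\<dots> = \<delta> k" using delta_nonneg[of k] by (simp add: powr_half_sqrt)
    also have "\<dots> \<le> G k" by (simp add: G_def rho_nonneg)
    finally show ?thesis .
  qed
  moreover have "z powr \<theta>' \<le> z powr \<xi>"
    using nonneg small \<theta> xi by (intro powr_mono') (auto simp: z_def)
  ultimately show ?thesis by (simp add: z_def algebra_simps)
qed

lemma converges_to_accumulation_point:
  assumes s: "strict_mono s" "(w \<circ> s) \<longlonglongrightarrow> z"
  shows "w \<longlonglongrightarrow> z"
proof -
  have cont: "continuous_on UNIV (grad f)" using lip by (rule lipschitz_on_continuous_on)
  obtain Vlim where Vlim: "V \<longlonglongrightarrow> Vlim" "\<forall>\<^sub>F k in sequentially. Vlim \<le> V k"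
    using V_convergent_and_decrease_summable by blast
  have "(\<lambda>k. V k - K * (a k * (\<delta> k)\<^sup>2) - A * u k) \<longlonglongrightarrow> Vlim - 0 - A * 0"
    by (intro tendsto_intros Vlim momentum_energy_lim u_lim)
  then have "(\<lambda>k. f (w k)) \<longlonglongrightarrow> Vlim" by (simp add: V_def)
  then have "(\<lambda>k. f (w (s k))) \<longlonglongrightarrow> Vlim"
    using s(1) LIMSEQ_subseq_LIMSEQ by (fastforce simp: o_def)
  moreover have "isCont f z" using diff differentiable_imp_continuous_within by blast
  then have "(\<lambda>k. f (w (s k))) \<longlonglongrightarrow> f z"
    using isCont_tendsto_compose[of z f "w \<circ> s" sequentially] s(2) by (simp add: o_def)
  ultimately have fz: "f z = Vlim" by (metis LIMSEQ_unique)
  obtain R B \<theta> where R: "0 < R" "0 \<le> B" "1/2 \<le> \<theta>" "\<theta> < 1"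
    and loj_ball: "\<And>x. x \<in> ball z R \<Longrightarrow> \<bar>f x - f z\<bar> \<le> 1"
      "\<And>x. x \<in> ball z R \<Longrightarrow> \<bar>f x - f z\<bar> powr \<theta> \<le> B * norm (grad f x)"
    using local_Lojasiewicz[OF diff cont loj, of z] by metis
  define \<theta>' where "\<theta>' = max \<theta> \<xi>"
  have \<theta>': "\<theta> \<le> \<theta>'" "\<xi> \<le> \<theta>'" "\<theta>' < 1" "0 < \<theta>'" using R xi by (auto simp: \<theta>'_def)
  have "(\<lambda>k. K * a k) \<longlonglongrightarrow> K * 0" "(\<lambda>k. A * u k) \<longlonglongrightarrow> A * 0"
    by (intro tendsto_intros a_lim u_lim)+
  then have small: "\<forall>\<^sub>F k in sequentially. K * a k < 1" "\<forall>\<^sub>F k in sequentially. A * u k < 1"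
      "\<forall>\<^sub>F k in sequentially. \<delta> k < 1"
    using delta_lim order_tendstoD(2)[where y = "0::real" and a = 1 and F = sequentially]
    by simp_all
  have "\<forall>\<^sub>F k in sequentially. K * a k \<le> 1 \<and> A * u k \<le> 1 \<and> \<delta> k \<le> 1 \<and> Vlim \<le> V k \<and>
      V (Suc k) \<le> V k - 1/12 * a k * (G k)\<^sup>2"
    using small Vlim(2) V_decreases by eventually_elim auto
  then obtain N where N: "\<And>k. k \<ge> N \<Longrightarrow> K * a k \<le> 1 \<and> A * u k \<le> 1 \<and> \<delta> k \<le> 1 \<and>
      Vlim \<le> V k \<and> V (Suc k) \<le> V k - 1/12 * a k * (G k)\<^sup>2"
    by (auto simp: eventually_sequentially)
  define c where "c = (1 + \<bar>C\<bar>) * (((B + 1) + 1) / (1/12 * (1 - \<theta>')))"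
  define P where "P k = c * \<bar>V k - Vlim\<bar> powr (1 - \<theta>')" for k
  define t where "t k = (1 + \<bar>C\<bar>) * (a k * (A * u k) powr \<xi>)" for k
  have c: "0 \<le> c" using R \<theta>' by (auto simp: c_def)
  show ?thesis
  proof (rule trapped_near_accumulation_point[OF R(1), of z w N P t])
    show "\<exists>k\<ge>M. dist z (w k) < \<epsilon>" if "0 < \<epsilon>" for \<epsilon> M
    proof -
      obtain m where m: "\<And>k. k \<ge> m \<Longrightarrow> dist (w (s k)) z < \<epsilon>"
        using metric_LIMSEQ_D[OF s(2) \<open>0 < \<epsilon>\<close>] by auto
      have "M \<le> s (m + M)" using seq_suble[OF s(1), of "m + M"] by simp
      then show ?thesis using m[of "m + M"] by (metis dist_commute le_add1)
    qed
    show "norm (w (Suc k) - w k) \<le> P k - P (Suc k) + t k" if k: "k \<ge> N" "w k \<in> ball z R" for k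
    proof -
      have nonneg: "0 \<le> V k - Vlim" "0 \<le> V (Suc k) - Vlim" using N[of k] N[of "Suc k"] k by auto
      have "a k * G k \<le> ((B + 1) + 1) / (1/12 * (1 - \<theta>')) *
          ((V k - Vlim) powr (1 - \<theta>') - (V (Suc k) - Vlim) powr (1 - \<theta>')) + a k * (A * u k) powr \<xi>"
      proof (rule desingularised_decrease)
        show "(V k - Vlim) powr \<theta>' \<le> (B + 1) * G k + (A * u k) powr \<xi>"
          using loj_ball[OF k(2)] N[OF k(1)] R \<theta>' nonneg fz by (intro excess_powr_le[of \<theta>]) auto
        show "1/12 * a k * (G k)\<^sup>2 \<le> V k - Vlim - (V (Suc k) - Vlim)" using N[OF k(1)] by simp
      qed (use nonneg \<theta>' R G_nonneg a_pos in auto)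
      then have "(1 + \<bar>C\<bar>) * (a k * G k) \<le> (1 + \<bar>C\<bar>) * (((B + 1) + 1) / (1/12 * (1 - \<theta>')) *
          ((V k - Vlim) powr (1 - \<theta>') - (V (Suc k) - Vlim) powr (1 - \<theta>')) + a k * (A * u k) powr \<xi>)"
        by (intro mult_left_mono) auto
      also have "\<dots> = P k - P (Suc k) + t k"
        using nonneg unfolding P_def t_def c_def by (simp only: abs_of_nonneg ring_distribs)
      finally show ?thesis using step_length_le[of k] by linarith
    qed
    have "(\<lambda>k. c * \<bar>V k - Vlim\<bar> powr (1 - \<theta>')) \<longlonglongrightarrow> c * 0 powr (1 - \<theta>')"
      by (intro tendsto_intros tendsto_powr' tendsto_rabs_zero LIM_zero Vlim)
        (use \<theta>' in auto)
    then show "P \<longlonglongrightarrow> 0" by (simp add: P_def[abs_def])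
    have "(A * u k) powr \<xi> = A powr \<xi> * u k powr \<xi>" for k
      using A_nonneg u_nonneg by (simp add: powr_mult)
    then have "t = (\<lambda>k. (1 + \<bar>C\<bar>) * A powr \<xi> * (a k * u k powr \<xi>))" by (auto simp: t_def)
    then show "summable t"
      using summable_mult[OF tail_summable] by (simp only: u_def)
    show "0 \<le> P k" "0 \<le> t k" for k
      using c a_pos[of k] by (auto simp: P_def t_def)
  qed
qed

theorem diverges_or_converges_to_critical_point:
  "filterlim (\<lambda>k. norm (w k)) at_top sequentially \<or> (\<exists>z\<in>crit f. w \<longlonglongrightarrow> z)"
proof (cases "filterlim (\<lambda>k. norm (w k)) at_top sequentially")
  case False
  then obtain z s where "strict_mono (s :: nat \<Rightarrow> nat)" "(w \<circ> s) \<longlonglongrightarrow> z"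
    by (rule accumulation_point_if_not_diverging)
  then have w: "w \<longlonglongrightarrow> z" by (rule converges_to_accumulation_point)
  have "z \<in> crit f"
  proof (rule ccontr)
    assume "z \<notin> crit f"
    then have c: "0 < norm (grad f z)" by (simp add: crit_def)
    have cont: "isCont (grad f) z"
      using lipschitz_on_continuous_on[OF lip] by (simp add: continuous_on_eq_continuous_at)
    have "(\<lambda>k. norm (grad f (w k))) \<longlonglongrightarrow> norm (grad f z)"
      by (intro tendsto_norm isCont_tendsto_compose[OF cont] w)
    then have "\<forall>\<^sub>F k in sequentially. norm (grad f z) / 2 < norm (grad f (w k))"
      using c by (intro order_tendstoD(1)) auto
    then have "\<forall>\<^sub>F k in sequentially.
        norm (a k) \<le> (2 / norm (grad f z))\<^sup>2 * (a k * (G k)\<^sup>2)"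
    proof eventually_elim
      case (elim k)
      then have "1 \<le> 2 / norm (grad f z) * G k"
        using c norm_grad_le_G[of k] by (simp add: field_simps)
      then have "a k * 1 \<le> a k * (2 / norm (grad f z) * G k)\<^sup>2"
        using a_pos[of k] by (intro mult_left_mono) (auto simp: one_le_power)
      then show ?case using a_pos[of k] by (simp only: power_mult_distrib) (simp add: ac_simps)
    qed
    moreover obtain Vlim where "summable (\<lambda>k. a k * (G k)\<^sup>2)"
      using V_convergent_and_decrease_summable by blast
    then have "summable (\<lambda>k. (2 / norm (grad f z))\<^sup>2 * (a k * (G k)\<^sup>2))" by (rule summable_mult)
    ultimately have "summable a" by (rule summable_comparison_test_ev)
    then show False using a_divergent by simp
  qed
  then show ?thesis using w by blast
qed simp

end

section \<open>Weighted summability\<close>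

lemma summable_over_partial_sums_powr:
  fixes a S :: "nat \<Rightarrow> real"
  assumes p: "1 < p" and a: "\<And>k. 0 < a k" and S: "\<And>k. 0 < S k" "\<And>k. S (Suc k) = S k + a (Suc k)"
  shows "summable (\<lambda>k. a k * S k powr - p)"
proof -
  have tangent: "(p - 1) * (a (Suc k) * S (Suc k) powr - p) \<le> S k powr (1 - p) - S (Suc k) powr (1 - p)"
    for k
  proof -
    define s where "s = S k / S (Suc k)"
    have s: "0 < s" using S(1) by (simp add: s_def)
    have "1 + (p - 1) * (1 - s) \<le> 1 + (1 - p) * ln s"
      using ln_le_minus_one[OF s] p mult_left_mono[of "ln s" "s - 1" "p - 1"]
      by (simp add: algebra_simps)
    also have "\<dots> \<le> exp ((1 - p) * ln s)" using exp_ge_add_one_self by blast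
    also have "\<dots> = s powr (1 - p)" using s by (simp add: powr_def)
    finally have "S (Suc k) powr (1 - p) * (1 + (p - 1) * (1 - s))
        \<le> S (Suc k) powr (1 - p) * s powr (1 - p)"
      by (intro mult_left_mono) auto
    also have "\<dots> = S k powr (1 - p)"
      using S(1)[of k] S(1)[of "Suc k"] by (simp add: s_def powr_divide)
    finally have "(p - 1) * (S (Suc k) powr (1 - p) * (1 - s))
        \<le> S k powr (1 - p) - S (Suc k) powr (1 - p)"
      by (simp add: algebra_simps)
    moreover have "S (Suc k) powr (1 - p) * (1 - s) = a (Suc k) * S (Suc k) powr - p"
    proof -
      have "1 - s = a (Suc k) / S (Suc k)"
        using S(1)[of "Suc k"] S(2)[of k] by (simp add: s_def field_simps)
      moreover have "S (Suc k) powr (1 - p) = S (Suc k) * S (Suc k) powr - p"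
        using S(1)[of "Suc k"] powr_add[of "S (Suc k)" 1 "- p"] by simp
      ultimately show ?thesis using S(1)[of "Suc k"] by simp
    qed
    ultimately show ?thesis by simp
  qed
  have "summable (\<lambda>k. (p - 1) * (a (Suc k) * S (Suc k) powr - p))"
  proof (rule summableI_nonneg_bounded)
    show "0 \<le> (p - 1) * (a (Suc k) * S (Suc k) powr - p)" for k using p a[of "Suc k"] by simp
    show "(\<Sum>k<n. (p - 1) * (a (Suc k) * S (Suc k) powr - p)) \<le> S 0 powr (1 - p)" for n
    proof -
      have "(\<Sum>k<n. (p - 1) * (a (Suc k) * S (Suc k) powr - p))
          \<le> (\<Sum>k<n. S k powr (1 - p) - S (Suc k) powr (1 - p))"
        by (intro sum_mono tangent)
      also have "\<dots> = S 0 powr (1 - p) - S n powr (1 - p)"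
        by (rule sum_lessThan_telescope')
      also have "\<dots> \<le> S 0 powr (1 - p)" by simp
      finally show ?thesis .
    qed
  qed
  then have "summable (\<lambda>k. a (Suc k) * S (Suc k) powr - p)"
    using p by (simp only: summable_cmult_iff) simp
  then show ?thesis by (rule summable_Suc_iff[THEN iffD1])
qed

text \<open>The weight \<open>S powr q\<close> makes the tails of \<open>t\<close> decay like \<open>S powr - q\<close>. Since \<open>q > 1\<close>, there is
  room to raise them to a power slightly below one without losing summability against \<open>a\<close>.\<close>

lemma weighted_tails_powr_summable:
  fixes a S t :: "nat \<Rightarrow> real"
  assumes q: "1 < q" and a: "\<And>k. 0 < a k" and S: "\<And>k. 0 < S k" "\<And>k. S (Suc k) = S k + a (Suc k)"
    and t: "\<And>k. 0 \<le> t k" "summable (\<lambda>k. S k powr q * t k)" "summable t"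
  defines "\<xi> \<equiv> (1 + 1 / q) / 2"
  shows "summable (\<lambda>k. a k * (\<Sum>j. t (j + k)) powr \<xi>)"
proof -
  define B where "B = (\<Sum>k. S k powr q * t k)"
  have \<xi>: "0 < \<xi>" "1 < q * \<xi>" using q by (auto simp: \<xi>_def field_simps)
  have mono: "S k \<le> S (j + k)" for j k
    by (induction j) (use S(2) a in \<open>auto intro: add_increasing2 less_imp_le\<close>)
  have tail: "(\<Sum>j. t (j + k)) \<le> B * S k powr - q" for k
  proof -
    have "S k powr q * (\<Sum>j. t (j + k)) = (\<Sum>j. S k powr q * t (j + k))"
      using t(3) by (intro suminf_mult[symmetric]) (simp add: summable_iff_shift)
    also have "\<dots> \<le> (\<Sum>j. S (j + k) powr q * t (j + k))"
    proof (rule suminf_le)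
      show "S k powr q * t (j + k) \<le> S (j + k) powr q * t (j + k)" for j
        using mono[of k j] S(1)[of k] q t(1) by (intro mult_right_mono powr_mono2) auto
      show "summable (\<lambda>j. S k powr q * t (j + k))"
        using t(3) by (intro summable_mult) (simp add: summable_iff_shift)
      show "summable (\<lambda>j. S (j + k) powr q * t (j + k))"
        using t(2) by (rule summable_ignore_initial_segment)
    qed
    also have "\<dots> = B - (\<Sum>i<k. S i powr q * t i)"
      unfolding B_def by (rule suminf_minus_initial_segment[OF t(2)])
    also have "\<dots> \<le> B" using t(1) by (simp add: sum_nonneg)
    finally show ?thesis using S(1)[of k] by (simp add: powr_minus field_simps)
  qed
  have nonneg: "0 \<le> (\<Sum>j. t (j + k))" for k
    using t by (intro suminf_nonneg) (auto simp: summable_iff_shift)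
  show ?thesis
  proof (rule summable_comparison_test)
    show "summable (\<lambda>k. B powr \<xi> * (a k * S k powr - (q * \<xi>)))"
      by (intro summable_mult summable_over_partial_sums_powr \<xi> a S)
    show "\<exists>N. \<forall>k\<ge>N. norm (a k * (\<Sum>j. t (j + k)) powr \<xi>) \<le> B powr \<xi> * (a k * S k powr - (q * \<xi>))"
    proof (intro exI allI impI)
      fix k
      have B: "0 \<le> B" using t by (auto simp: B_def intro!: suminf_nonneg)
      have "(\<Sum>j. t (j + k)) powr \<xi> \<le> (B * S k powr - q) powr \<xi>"
        using tail nonneg \<xi> by (intro powr_mono2) auto
      also have "\<dots> = B powr \<xi> * S k powr - (q * \<xi>)"
        using B by (simp add: powr_mult powr_powr)
      finally show "norm (a k * (\<Sum>j. t (j + k)) powr \<xi>) \<le> B powr \<xi> * (a k * S k powr - (q * \<xi>))"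
        using mult_left_mono[of _ _ "a k"] a[of k] by (simp add: abs_mult ac_simps)
    qed
  qed
qed

text \<open>Averaging with rate \<open>a k\<close> beats the growth of the weight \<open>S powr q\<close>: once \<open>S k \<ge> 2 * q\<close>, the
  weight grows by a factor of at most \<open>exp (a k / 2)\<close> in a step, while the averaging gains the
  factor \<open>1 - a k\<close>.\<close>

lemma weighted_averaging:
  fixes a S Q :: "nat \<Rightarrow> real"
  assumes q: "0 \<le> q" and a: "\<And>k. 0 < a k" "\<And>k. a k \<le> 1" "\<And>k. a (Suc k) \<le> a k"
    and S: "\<And>k. 2 * q \<le> S k" "\<And>k. a k \<le> S k" "\<And>k. S (Suc k) = S k + a (Suc k)"
    and Q: "\<And>k. 0 \<le> Q k" "\<And>k. Q (Suc k) \<le> (1 - a k) * Q k + s * (a k)\<^sup>2" and s: "0 \<le> s"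
    and sum: "summable (\<lambda>k. (a k)\<^sup>2 * S k powr q)"
  shows "summable (\<lambda>k. a k * (S k powr q * Q k))" and "\<exists>B. \<forall>k. S k powr q * Q k \<le> B"
proof -
  define W where "W k = S k powr q * Q k" for k
  define b where "b k = s * 2 powr q * ((a k)\<^sup>2 * S k powr q)" for k
  have W: "0 \<le> W k" and b: "0 \<le> b k" for k using Q s by (auto simp: W_def b_def)
  have bsum: "summable b" unfolding b_def using sum by (rule summable_mult)
  have pos: "0 < S k" for k using a(1)[of k] S(2)[of k] by linarith
  have step: "W (Suc k) \<le> (1 - a k / 2) * W k + b k" for k
  proof -
    have "S (Suc k) \<le> S k + a k" using S(3) a(3) by simp
    also have "\<dots> = S k * (1 + a k / S k)" using pos[of k] by (simp add: field_simps)
    also have "\<dots> \<le> S k * exp (a k / S k)" using pos[of k] by (intro mult_left_mono) auto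
    finally have "S (Suc k) powr q \<le> (S k * exp (a k / S k)) powr q"
      using q pos[of "Suc k"] by (intro powr_mono2) auto
    also have "\<dots> = S k powr q * exp (q * (a k / S k))"
      using pos[of k] by (simp add: powr_mult exp_powr_real mult.commute)
    also have "\<dots> \<le> S k powr q * exp (a k / 2)"
    proof -
      have "q * (a k / S k) \<le> a k / 2"
        using S(1)[of k] a(1)[of k] pos[of k] mult_right_mono[of "2 * q" "S k" "a k"]
        by (simp add: field_simps)
      then show ?thesis by (intro mult_left_mono) auto
    qed
    finally have 1: "S (Suc k) powr q \<le> S k powr q * exp (a k / 2)" .
    have "(1 - a k) \<le> (1 - a k / 2) * (1 - a k / 2)" by (simp add: algebra_simps)
    also have "\<dots> \<le> (1 - a k / 2) * exp (- (a k / 2))"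
      using a(2)[of k] exp_ge_add_one_self[of "- (a k / 2)"] by (intro mult_left_mono) auto
    finally have 2: "exp (a k / 2) * (1 - a k) \<le> 1 - a k / 2"
      by (simp add: exp_minus field_simps)
    have "S (Suc k) \<le> 2 * S k" using S(2)[of k] S(3)[of k] a(3)[of k] by simp
    then have 3: "S (Suc k) powr q \<le> 2 powr q * S k powr q"
      using q pos[of k] pos[of "Suc k"] powr_mono2[of q "S (Suc k)" "2 * S k"]
      by (simp add: powr_mult)
    have "W (Suc k) \<le> S (Suc k) powr q * ((1 - a k) * Q k + s * (a k)\<^sup>2)"
      unfolding W_def using Q by (intro mult_left_mono) auto
    also have "\<dots> = S (Suc k) powr q * ((1 - a k) * Q k) + S (Suc k) powr q * (s * (a k)\<^sup>2)"
      by (simp add: algebra_simps)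
    also have "\<dots> \<le> (S k powr q * exp (a k / 2)) * ((1 - a k) * Q k)
        + (2 powr q * S k powr q) * (s * (a k)\<^sup>2)"
      using 1 3 a(2) Q(1) s by (intro add_mono mult_right_mono) auto
    also have "(S k powr q * exp (a k / 2)) * ((1 - a k) * Q k)
        = (exp (a k / 2) * (1 - a k)) * W k" by (simp add: W_def)
    also have "\<dots> \<le> (1 - a k / 2) * W k" by (rule mult_right_mono[OF 2 W])
    finally show ?thesis by (simp add: b_def ac_simps)
  qed
  have bound: "W n + (\<Sum>k<n. a k / 2 * W k) \<le> W 0 + (\<Sum>k<n. b k)" for n
  proof (induction n)
    case (Suc n)
    then show ?case using step[of n] by (simp add: algebra_simps)
  qed simp
  also have "W 0 + (\<Sum>k<n. b k) \<le> W 0 + suminf b" for n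
    using bsum b by (simp add: sum_le_suminf)
  finally have bound': "W n + (\<Sum>k<n. a k / 2 * W k) \<le> W 0 + suminf b" for n .
  have nonneg: "0 \<le> a k / 2 * W k" for k using a(1)[of k] W[of k] by simp
  have "summable (\<lambda>k. a k / 2 * W k)"
  proof (rule summableI_nonneg_bounded)
    show "(\<Sum>k<n. a k / 2 * W k) \<le> W 0 + suminf b" for n
      using bound'[of n] W[of n] by linarith
  qed (rule nonneg)
  then have "summable (\<lambda>k. 2 * (a k / 2 * W k))" by (rule summable_mult)
  then show "summable (\<lambda>k. a k * (S k powr q * Q k))" by (simp add: W_def)
  have "W k \<le> W 0 + suminf b" for k
    using bound'[of k] sum_nonneg[of "{..<k}" "\<lambda>k. a k / 2 * W k"] nonneg by simp
  then show "\<exists>B. \<forall>k. S k powr q * Q k \<le> B" unfolding W_def by blast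
qed

section \<open>Martingale noise\<close>

lemma AE_summable_if_expectations_summable:
  fixes Y :: "nat \<Rightarrow> 'w \<Rightarrow> real"
  assumes int: "\<And>k. integrable M (Y k)" and nonneg: "\<And>k \<omega>. 0 \<le> Y k \<omega>"
    and bound: "\<And>k. (\<integral>\<omega>. Y k \<omega> \<partial>M) \<le> c k" and sum: "summable c"
  shows "AE \<omega> in M. summable (\<lambda>k. Y k \<omega>)"
proof -
  have [measurable]: "Y k \<in> borel_measurable M" for k using int by auto
  have c: "0 \<le> c k" for k
    using bound[of k] nonneg by (smt (verit) integral_nonneg_AE AE_I2)
  have "(\<integral>\<^sup>+\<omega>. (\<Sum>k. ennreal (Y k \<omega>)) \<partial>M) = (\<Sum>k. \<integral>\<^sup>+\<omega>. ennreal (Y k \<omega>) \<partial>M)"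
    by (rule nn_integral_suminf) measurable
  also have "\<dots> = (\<Sum>k. ennreal (\<integral>\<omega>. Y k \<omega> \<partial>M))"
    using nn_integral_eq_integral[OF int] nonneg by simp
  also have "\<dots> \<le> (\<Sum>k. ennreal (c k))"
    using bound by (intro suminf_le ennreal_leI) auto
  also have "\<dots> = ennreal (suminf c)" using c sum by (intro suminf_ennreal2) auto
  finally have "(\<integral>\<^sup>+\<omega>. (\<Sum>k. ennreal (Y k \<omega>)) \<partial>M) \<noteq> \<infinity>" by (auto simp: top_unique)
  moreover have "(\<lambda>\<omega>. \<Sum>k. ennreal (Y k \<omega>)) \<in> borel_measurable M" by measurable
  ultimately have "AE \<omega> in M. (\<Sum>k. ennreal (Y k \<omega>)) \<noteq> \<infinity>"
    by (rule nn_integral_PInf_AE[rotated])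
  then show ?thesis
    by eventually_elim (use nonneg summable_suminf_not_top in auto)
qed

text \<open>Square integrable martingale differences \<open>\<xi> k\<close>, and the process \<open>Y\<close> that forgets its past at the
  rate prescribed by the factors \<open>c k\<close> while taking up the noise.\<close>

locale damped_martingale = prob_space M
  for M :: "'w measure" and F :: "nat \<Rightarrow> 'w measure"
    and \<xi> Y :: "nat \<Rightarrow> 'w \<Rightarrow> 'a::euclidean_space" and c :: "nat \<Rightarrow> real" +
  assumes subalg: "\<And>k. subalgebra M (F k)" and filtration: "\<And>k. subalgebra (F (Suc k)) (F k)"
    and adapted: "\<And>k. \<xi> k \<in> borel_measurable (F (Suc k))"
    and square_integrable: "\<And>k. integrable M (\<lambda>\<omega>. (norm (\<xi> k \<omega>))\<^sup>2)"
    and centred: "\<And>k. AE \<omega> in M. vec_cond_exp M (F k) (\<xi> k) \<omega> = 0"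
    and Y_0: "\<And>\<omega>. Y 0 \<omega> = 0"
    and Y_Suc: "\<And>k \<omega>. Y (Suc k) \<omega> = c k *\<^sub>R Y k \<omega> + \<xi> k \<omega>"
    and damping: "\<And>k. \<bar>c k\<bar> \<le> 1"
begin

lemma noise_measurable [measurable]: "\<xi> k \<in> borel_measurable M"
  using measurable_from_subalg[OF subalg adapted] .

lemma orthogonal:
  assumes Z: "Z \<in> borel_measurable (F k)" and Z2: "integrable M (\<lambda>\<omega>. (norm (Z \<omega>))\<^sup>2)"
  shows "integrable M (\<lambda>\<omega>. Z \<omega> \<bullet> \<xi> k \<omega>)" and "(\<integral>\<omega>. Z \<omega> \<bullet> \<xi> k \<omega> \<partial>M) = 0"
proof -
  interpret sub: finite_measure_subalgebra M "F k"
    by standard (rule subalg)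
  have ZM [measurable]: "Z \<in> borel_measurable M" using measurable_from_subalg[OF subalg Z] .
  have dom: "integrable M (\<lambda>\<omega>. (norm (Z \<omega>))\<^sup>2 + (norm (\<xi> k \<omega>))\<^sup>2)"
    using Z2 square_integrable by simp
  have product: "\<bar>u * v\<bar> \<le> s\<^sup>2 + t\<^sup>2" if "\<bar>u\<bar> \<le> s" "\<bar>v\<bar> \<le> t" for u v s t :: real
  proof -
    have "\<bar>u * v\<bar> \<le> s * t" using that by (simp add: abs_mult mult_mono)
    also have "\<dots> \<le> s\<^sup>2 + t\<^sup>2"
      using zero_le_power2[of "s - t"] zero_le_power2[of s] zero_le_power2[of t]
      unfolding power2_diff by linarith
    finally show ?thesis .
  qed
  have int: "integrable M (\<lambda>\<omega>. (Z \<omega> \<bullet> b) * (\<xi> k \<omega> \<bullet> b))" if "b \<in> Basis" for b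
    by (rule Bochner_Integration.integrable_bound[OF dom])
      (use product Basis_le_norm[OF that] in \<open>auto intro!: AE_I2\<close>)
  have zero: "(\<integral>\<omega>. (Z \<omega> \<bullet> b) * (\<xi> k \<omega> \<bullet> b) \<partial>M) = 0" if b: "b \<in> Basis" for b
  proof -
    have "AE \<omega> in M. real_cond_exp M (F k) (\<lambda>\<omega>. \<xi> k \<omega> \<bullet> b) \<omega> = 0"
      using centred[of k]
    proof eventually_elim
      case (elim \<omega>)
      have "vec_cond_exp M (F k) (\<xi> k) \<omega> \<bullet> b = real_cond_exp M (F k) (\<lambda>\<omega>. \<xi> k \<omega> \<bullet> b) \<omega>"
        using b by (simp add: vec_cond_exp_def inner_sum_left_Basis)
      then show ?case using elim by simp
    qed
    then have "(\<integral>\<omega>. (Z \<omega> \<bullet> b) * real_cond_exp M (F k) (\<lambda>\<omega>. \<xi> k \<omega> \<bullet> b) \<omega> \<partial>M) = (\<integral>\<omega>. 0 \<partial>M)"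
      by (intro integral_cong_AE) (auto elim: eventually_mono)
    moreover have "(\<lambda>\<omega>. Z \<omega> \<bullet> b) \<in> borel_measurable (F k)" using Z by measurable
    ultimately show ?thesis using sub.real_cond_exp_intg(2)[OF int[OF b]] by simp
  qed
  have eq: "Z \<omega> \<bullet> \<xi> k \<omega> = (\<Sum>b\<in>Basis. (Z \<omega> \<bullet> b) * (\<xi> k \<omega> \<bullet> b))" for \<omega>
    by (rule euclidean_inner)
  show "integrable M (\<lambda>\<omega>. Z \<omega> \<bullet> \<xi> k \<omega>)" unfolding eq using int by auto
  show "(\<integral>\<omega>. Z \<omega> \<bullet> \<xi> k \<omega> \<partial>M) = 0" unfolding eq using int zero by simp
qed

lemma Y_adapted: "Y k \<in> borel_measurable (F k)"
proof (induction k)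
  case (Suc k)
  have "Y k \<in> borel_measurable (F (Suc k))" using measurable_from_subalg[OF filtration Suc] .
  then show ?case using adapted[of k] by (subst measurable_cong[OF Y_Suc]) simp
next
  case 0
  show ?case by (subst measurable_cong[OF Y_0]) simp
qed

lemma Y_measurable [measurable]: "Y k \<in> borel_measurable M"
  using measurable_from_subalg[OF subalg Y_adapted] .

lemma norm_Y_Suc: "(norm (Y (Suc k) \<omega>))\<^sup>2 =
    (c k)\<^sup>2 * (norm (Y k \<omega>))\<^sup>2 + 2 * ((c k *\<^sub>R Y k \<omega>) \<bullet> \<xi> k \<omega>) + (norm (\<xi> k \<omega>))\<^sup>2"
  unfolding Y_Suc power2_norm_eq_inner
  by (simp add: inner_add_left inner_add_right inner_commute power2_eq_square)

lemma Y_square_integrable: "integrable M (\<lambda>\<omega>. (norm (Y k \<omega>))\<^sup>2)"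
proof (induction k)
  case (Suc k)
  have "integrable M (\<lambda>\<omega>. (c k *\<^sub>R Y k \<omega>) \<bullet> \<xi> k \<omega>)"
    using Suc Y_adapted[of k] by (intro orthogonal) (auto simp: power_mult_distrib)
  then show ?case unfolding norm_Y_Suc using Suc square_integrable by simp
qed (simp add: Y_0)

lemma Y_second_moment:
  "(\<integral>\<omega>. (norm (Y (Suc k) \<omega>))\<^sup>2 \<partial>M)
    = (c k)\<^sup>2 * (\<integral>\<omega>. (norm (Y k \<omega>))\<^sup>2 \<partial>M) + (\<integral>\<omega>. (norm (\<xi> k \<omega>))\<^sup>2 \<partial>M)"
proof -
  have "integrable M (\<lambda>\<omega>. (c k *\<^sub>R Y k \<omega>) \<bullet> \<xi> k \<omega>)" "(\<integral>\<omega>. (c k *\<^sub>R Y k \<omega>) \<bullet> \<xi> k \<omega> \<partial>M) = 0"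
    using Y_square_integrable Y_adapted[of k]
    by (intro orthogonal; auto simp: power_mult_distrib)+
  then show ?thesis
    unfolding norm_Y_Suc using Y_square_integrable square_integrable by simp
qed

text \<open>Kolmogorov's maximal inequality. The random variable \<open>T n\<close> below dominates the squared norm of
  the process stopped when it first leaves the ball of radius \<open>\<epsilon>\<close>; its cross terms only involve
  the noise before the exit and therefore have mean zero.\<close>

lemma maximal_inequality:
  assumes \<epsilon>: "0 < \<epsilon>" and sum: "summable (\<lambda>k. \<integral>\<omega>. (norm (\<xi> k \<omega>))\<^sup>2 \<partial>M)"
  shows "\<epsilon>\<^sup>2 * \<P>(\<omega> in M. \<exists>n\<ge>m. \<epsilon> \<le> norm (Y n \<omega>))
    \<le> (\<integral>\<omega>. (norm (Y m \<omega>))\<^sup>2 \<partial>M) + (\<Sum>j. \<integral>\<omega>. (norm (\<xi> (j + m) \<omega>))\<^sup>2 \<partial>M)"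
    (is "_ * prob ?B \<le> ?R")
proof -
  define D where "D n \<omega> \<longleftrightarrow> (\<exists>j\<le>n. \<epsilon> \<le> norm (Y (j + m) \<omega>))" for n \<omega>
  define Z where "Z n \<omega> = (if D n \<omega> then 0 else c (n + m) *\<^sub>R Y (n + m) \<omega>)" for n \<omega>
  define T where "T n \<omega> = (norm (Y m \<omega>))\<^sup>2
    + (\<Sum>j<n. 2 * (Z j \<omega> \<bullet> \<xi> (j + m) \<omega>) + (norm (\<xi> (j + m) \<omega>))\<^sup>2)" for n \<omega>
  have Y_later: "Y j \<in> borel_measurable (F (i + j))" for i j
  proof (induction i)
    case (Suc i)
    then show ?case using measurable_from_subalg[OF filtration Suc] by simp
  qed (simp add: Y_adapted)
  have *: "Y (j + m) \<in> borel_measurable (F (n + m))" if "j \<le> n" for j n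
    using Y_later[of "j + m" "n - j"] that by simp
  have D_meas: "Measurable.pred (F (n + m)) (D n)" for n
  proof -
    have "D n = (\<lambda>\<omega>. \<exists>j\<in>{..n}. \<epsilon> \<le> norm (Y (j + m) \<omega>))" by (simp add: fun_eq_iff D_def atMost_iff Bex_def)
    moreover have "Measurable.pred (F (n + m)) (\<lambda>\<omega>. \<epsilon> \<le> norm (Y (j + m) \<omega>))" if "j \<in> {..n}" for j
    proof -
      have [measurable]: "Y (j + m) \<in> borel_measurable (F (n + m))" using * that by simp
      show ?thesis by measurable
    qed
    ultimately show ?thesis by (simp add: pred_intros_finite)
  qed
  have Z_meas: "Z n \<in> borel_measurable (F (n + m))" for n
    unfolding Z_def using D_meas[of n] Y_adapted[of "n + m"] by measurable
  have [measurable]: "Z n \<in> borel_measurable M" for n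
    using measurable_from_subalg[OF subalg Z_meas] .
  have [measurable]: "Measurable.pred M (D n)" for n
    unfolding D_def by measurable
  have Z2: "integrable M (\<lambda>\<omega>. (norm (Z n \<omega>))\<^sup>2)" for n
  proof (rule Bochner_Integration.integrable_bound[OF Y_square_integrable[of "n + m"]])
    have "norm (Z n \<omega>) \<le> norm (Y (n + m) \<omega>)" for \<omega>
      using damping[of "n + m"] by (simp add: Z_def mult_left_le_one_le)
    then show "AE \<omega> in M. norm ((norm (Z n \<omega>))\<^sup>2) \<le> norm ((norm (Y (n + m) \<omega>))\<^sup>2)"
      by (intro AE_I2) (simp add: power_mono)
  qed measurable
  have T_int: "integrable M (T n)" for n
    unfolding T_def using Y_square_integrable square_integrable orthogonal(1)[OF Z_meas Z2] by simp
  have T_exp: "(\<integral>\<omega>. T n \<omega> \<partial>M) =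
      (\<integral>\<omega>. (norm (Y m \<omega>))\<^sup>2 \<partial>M) + (\<Sum>j<n. \<integral>\<omega>. (norm (\<xi> (j + m) \<omega>))\<^sup>2 \<partial>M)" for n
    unfolding T_def
    using Y_square_integrable square_integrable orthogonal[OF Z_meas Z2] by simp
  have T_bound: "(if D n \<omega> then \<epsilon>\<^sup>2 else (norm (Y (n + m) \<omega>))\<^sup>2) \<le> T n \<omega>" for n \<omega>
  proof (induction n)
    case 0
    then show ?case using \<epsilon> by (auto simp: T_def D_def power_mono)
  next
    case (Suc n)
    have T: "T (Suc n) \<omega> = T n \<omega> + 2 * (Z n \<omega> \<bullet> \<xi> (n + m) \<omega>) + (norm (\<xi> (n + m) \<omega>))\<^sup>2"
      by (simp add: T_def)
    show ?case
    proof (cases "D n \<omega>")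
      case True
      then have "D (Suc n) \<omega>" unfolding D_def using le_SucI by blast
      then show ?thesis using True Suc T by (simp add: Z_def add_increasing2)
    next
      case False
      have "(c (n + m))\<^sup>2 * (norm (Y (n + m) \<omega>))\<^sup>2 \<le> 1 * (norm (Y (n + m) \<omega>))\<^sup>2"
        using damping[of "n + m"] by (intro mult_right_mono) (auto simp: abs_square_le_1)
      then have "(norm (Y (Suc n + m) \<omega>))\<^sup>2 \<le> T (Suc n) \<omega>"
        using False Suc T norm_Y_Suc[of "n + m" \<omega>] by (simp add: Z_def)
      moreover have "\<epsilon>\<^sup>2 \<le> (norm (Y (Suc n + m) \<omega>))\<^sup>2" if "D (Suc n) \<omega>"
        using that False \<epsilon> by (auto simp: D_def le_Suc_eq intro!: power_mono)
      ultimately show ?thesis by auto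
    qed
  qed
  have D_prob: "\<epsilon>\<^sup>2 * prob {\<omega> \<in> space M. D n \<omega>} \<le> ?R" for n
  proof -
    have "\<epsilon>\<^sup>2 * prob {\<omega> \<in> space M. D n \<omega>} = (\<integral>\<omega>. \<epsilon>\<^sup>2 * indicator {\<omega> \<in> space M. D n \<omega>} \<omega> \<partial>M)"
      by simp
    also have "\<dots> \<le> (\<integral>\<omega>. T n \<omega> \<partial>M)"
    proof (rule integral_mono)
      fix \<omega> assume "\<omega> \<in> space M"
      show "\<epsilon>\<^sup>2 * indicator {\<omega> \<in> space M. D n \<omega>} \<omega> \<le> T n \<omega>"
        using T_bound[of n \<omega>] \<open>\<omega> \<in> space M\<close>
        by (cases "D n \<omega>") (auto intro: order_trans[OF zero_le_power2])
    qed (use T_int in \<open>auto simp: emeasure_finite less_top[symmetric]\<close>)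
    also have "\<dots> \<le> ?R"
      unfolding T_exp using summable_ignore_initial_segment[OF sum, of m]
      by (intro add_mono sum_le_suminf) auto
    finally show ?thesis .
  qed
  have "(\<lambda>n. prob {\<omega> \<in> space M. D n \<omega>}) \<longlonglongrightarrow> prob (\<Union>n. {\<omega> \<in> space M. D n \<omega>})"
    by (intro finite_Lim_measure_incseq) (auto simp: incseq_def D_def intro: order_trans)
  also have "(\<Union>n. {\<omega> \<in> space M. D n \<omega>}) = ?B"
    by (auto simp: D_def) (metis le_add2, metis le_add_diff_inverse2 order_refl)
  finally have "(\<lambda>n. \<epsilon>\<^sup>2 * prob {\<omega> \<in> space M. D n \<omega>}) \<longlonglongrightarrow> \<epsilon>\<^sup>2 * prob ?B"
    by (intro tendsto_intros)
  then show ?thesis using D_prob by (intro LIMSEQ_le_const2) auto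
qed

lemma AE_tendsto_zero:
  assumes sum: "summable (\<lambda>k. \<integral>\<omega>. (norm (\<xi> k \<omega>))\<^sup>2 \<partial>M)"
    and lim: "(\<lambda>k. \<integral>\<omega>. (norm (Y k \<omega>))\<^sup>2 \<partial>M) \<longlonglongrightarrow> 0"
  shows "AE \<omega> in M. (\<lambda>k. Y k \<omega>) \<longlonglongrightarrow> 0"
proof -
  define R where "R m = (\<integral>\<omega>. (norm (Y m \<omega>))\<^sup>2 \<partial>M) + (\<Sum>j. \<integral>\<omega>. (norm (\<xi> (j + m) \<omega>))\<^sup>2 \<partial>M)" for m
  have "(\<lambda>m. suminf (\<lambda>k. \<integral>\<omega>. (norm (\<xi> k \<omega>))\<^sup>2 \<partial>M) - (\<Sum>k<m. \<integral>\<omega>. (norm (\<xi> k \<omega>))\<^sup>2 \<partial>M)) \<longlonglongrightarrow>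
      suminf (\<lambda>k. \<integral>\<omega>. (norm (\<xi> k \<omega>))\<^sup>2 \<partial>M) - suminf (\<lambda>k. \<integral>\<omega>. (norm (\<xi> k \<omega>))\<^sup>2 \<partial>M)"
    by (intro tendsto_intros summable_LIMSEQ sum)
  then have R: "R \<longlonglongrightarrow> 0"
    unfolding R_def using tendsto_add[OF lim] suminf_minus_initial_segment[OF sum] by simp
  have "AE \<omega> in M. \<exists>m. \<forall>n\<ge>m. norm (Y n \<omega>) < \<epsilon>" if \<epsilon>: "0 < \<epsilon>" for \<epsilon>
  proof -
    define B where "B m = {\<omega> \<in> space M. \<exists>n\<ge>m. \<epsilon> \<le> norm (Y n \<omega>)}" for m
    have B: "B m \<in> events" for m unfolding B_def by measurable
    have le: "prob (\<Inter>m. B m) \<le> R m / \<epsilon>\<^sup>2" for m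
    proof -
      have "prob (\<Inter>m. B m) \<le> prob (B m)" using B by (intro finite_measure_mono) auto
      also have "\<dots> \<le> R m / \<epsilon>\<^sup>2"
        using maximal_inequality[OF \<epsilon> sum, of m] \<epsilon> by (simp add: R_def B_def field_simps)
      finally show ?thesis .
    qed
    have "(\<lambda>m. R m / \<epsilon>\<^sup>2) \<longlonglongrightarrow> 0 / \<epsilon>\<^sup>2" by (intro tendsto_intros R) (use \<epsilon> in auto)
    then have "prob (\<Inter>m. B m) \<le> 0" using le by (intro LIMSEQ_le_const) auto
    then have "prob (\<Inter>m. B m) = 0" by (simp add: measure_le_0_iff)
    then have "(\<Inter>m. B m) \<in> null_sets M"
      using B by (auto simp: null_sets_def emeasure_eq_measure)
    then have "AE \<omega> in M. \<omega> \<notin> (\<Inter>m. B m)" by (rule AE_not_in)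
    then show ?thesis using AE_space by eventually_elim (auto simp: B_def, meson linorder_not_le)
  qed
  then have "AE \<omega> in M. \<forall>i. \<exists>m. \<forall>n\<ge>m. norm (Y n \<omega>) < inverse (real (Suc i))"
    by (subst AE_all_countable) simp
  then show ?thesis
  proof eventually_elim
    case (elim \<omega>)
    show ?case
    proof (rule LIMSEQ_I)
      fix \<epsilon> :: real assume "0 < \<epsilon>"
      then obtain i where "inverse (real (Suc i)) < \<epsilon>" using reals_Archimedean by blast
      then show "\<exists>no. \<forall>n\<ge>no. norm (Y n \<omega> - 0) < \<epsilon>" using elim by (metis diff_zero less_trans)
    qed
  qed
qed

text \<open>If the factors are \<open>1 - a k\<close> and the noise has size \<open>a k\<close>, then \<open>Y\<close> is an average of the noise
  over roughly the last unit of time, when time is measured by the sums of \<open>a\<close>. Therefore the squared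
  norms of \<open>Y\<close>, weighted by \<open>a\<close>, sum up in expectation to no more than those of the noise, and both
  sums stay finite with the additional weights \<open>S powr q\<close>.\<close>

lemma noise_averages_out:
  fixes a S :: "nat \<Rightarrow> real"
  assumes q: "1 \<le> q" and a: "\<And>k. 0 < a k" "\<And>k. a k \<le> 1" "\<And>k. a (Suc k) \<le> a k"
    and S: "\<And>k. 2 * q \<le> S k" "\<And>k. a k \<le> S k" "\<And>k. S (Suc k) = S k + a (Suc k)"
      "filterlim S at_top sequentially"
    and sum: "summable (\<lambda>k. (a k)\<^sup>2 * S k powr q)"
    and c: "\<And>k. c k = 1 - a k"
    and s: "0 \<le> s" "\<And>k. (\<integral>\<omega>. (norm (\<xi> k \<omega>))\<^sup>2 \<partial>M) \<le> s * (a k)\<^sup>2"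
  shows "AE \<omega> in M. (\<lambda>k. Y k \<omega>) \<longlonglongrightarrow> 0 \<and> summable (\<lambda>k. a k * (S k powr q * (norm (Y k \<omega>))\<^sup>2))
    \<and> summable (\<lambda>k. S k powr q * (norm (\<xi> k \<omega>))\<^sup>2)"
proof -
  define Q where "Q k = (\<integral>\<omega>. (norm (Y k \<omega>))\<^sup>2 \<partial>M)" for k
  have Q_nonneg: "0 \<le> Q k" for k by (simp add: Q_def)
  have Q_Suc: "Q (Suc k) \<le> (1 - a k) * Q k + s * (a k)\<^sup>2" for k
  proof -
    have "(c k)\<^sup>2 \<le> 1 - a k"
      using a(1)[of k] a(2)[of k] mult_left_le_one_le[of "1 - a k" "1 - a k"]
      by (simp add: c power2_eq_square)
    then have "(c k)\<^sup>2 * Q k \<le> (1 - a k) * Q k" by (rule mult_right_mono[OF _ Q_nonneg])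
    then show ?thesis using Y_second_moment[of k] s(2)[of k] by (simp add: Q_def)
  qed
  have q0: "0 \<le> q" using q by simp
  note avg = weighted_averaging[OF q0 a S(1,2,3) Q_nonneg Q_Suc s(1) sum]
  have sq_int: "integrable M (\<lambda>\<omega>. a k * (S k powr q * (norm (Y k \<omega>))\<^sup>2))"
      "integrable M (\<lambda>\<omega>. S k powr q * (norm (\<xi> k \<omega>))\<^sup>2)" for k
    using Y_square_integrable square_integrable by simp_all
  have 1: "AE \<omega> in M. summable (\<lambda>k. a k * (S k powr q * (norm (Y k \<omega>))\<^sup>2))"
    by (rule AE_summable_if_expectations_summable[OF sq_int(1) _ _ avg(1)])
      (use a in \<open>auto simp: Q_def less_imp_le\<close>)
  have 2: "AE \<omega> in M. summable (\<lambda>k. S k powr q * (norm (\<xi> k \<omega>))\<^sup>2)"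
  proof (rule AE_summable_if_expectations_summable[OF sq_int(2)])
    show "summable (\<lambda>k. s * ((a k)\<^sup>2 * S k powr q))" by (rule summable_mult[OF sum])
    show "(\<integral>\<omega>. S k powr q * (norm (\<xi> k \<omega>))\<^sup>2 \<partial>M) \<le> s * ((a k)\<^sup>2 * S k powr q)" for k
      using mult_left_mono[OF s(2)[of k], of "S k powr q"] by (simp add: ac_simps)
  qed simp
  have "AE \<omega> in M. (\<lambda>k. Y k \<omega>) \<longlonglongrightarrow> 0"
  proof (rule AE_tendsto_zero)
    have weight: "1 \<le> S k powr q" for k using S(1)[of k] q by (intro ge_one_powr_ge_zero) auto
    have "\<exists>N. \<forall>k\<ge>N. norm (\<integral>\<omega>. (norm (\<xi> k \<omega>))\<^sup>2 \<partial>M) \<le> s * ((a k)\<^sup>2 * S k powr q)"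
    proof (intro exI allI impI)
      fix k
      have "s * (a k)\<^sup>2 * 1 \<le> s * (a k)\<^sup>2 * S k powr q"
        using weight[of k] s(1) by (intro mult_left_mono) auto
      then show "norm (\<integral>\<omega>. (norm (\<xi> k \<omega>))\<^sup>2 \<partial>M) \<le> s * ((a k)\<^sup>2 * S k powr q)"
        using s(2)[of k] by (simp add: mult.assoc)
    qed
    then show "summable (\<lambda>k. \<integral>\<omega>. (norm (\<xi> k \<omega>))\<^sup>2 \<partial>M)"
      using summable_mult[OF sum] by (rule summable_comparison_test)
    obtain B where B: "\<And>k. S k powr q * Q k \<le> B" using avg(2) by blast
    have pos: "0 < S k powr q" for k using weight[of k] by linarith
    have "filterlim (\<lambda>k. S k powr q) at_top sequentially"
    proof (rule filterlim_at_top_mono[OF S(4)])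
      have "S k \<le> S k powr q" for k
      proof -
        have "1 \<le> S k" using S(1)[of k] q by linarith
        then have "S k powr 1 \<le> S k powr q" by (rule powr_mono[OF q])
        then show ?thesis using \<open>1 \<le> S k\<close> by simp
      qed
      then show "\<forall>\<^sub>F k in sequentially. S k \<le> S k powr q" by simp
    qed
    then have B_lim: "(\<lambda>k. B / S k powr q) \<longlonglongrightarrow> 0"
      by (rule real_tendsto_divide_at_top[OF tendsto_const])
    have Q_le: "Q k \<le> B / S k powr q" for k
      using B[of k] pos[of k] by (simp add: pos_le_divide_eq mult.commute)
    have "Q \<longlonglongrightarrow> 0"
      by (rule tendsto_sandwich[OF _ _ tendsto_const B_lim]) (simp_all add: Q_nonneg Q_le)
    then show "(\<lambda>k. \<integral>\<omega>. (norm (Y k \<omega>))\<^sup>2 \<partial>M) \<longlonglongrightarrow> 0" by (simp add: Q_def[abs_def])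
  qed
  with 1 2 show ?thesis by eventually_elim simp
qed

end

section \<open>Trajectories of the momentum method\<close>

text \<open>With \<open>d k = x (k + 1) - x k\<close>, the point \<open>x (k + 1) + (lam / (1 - lam)) * d k\<close> moves along the
  stochastic gradient alone, with step size \<open>a k\<close>. Subtracting the averaged noise \<open>y k\<close> gives points \<open>w k\<close> with
  \<open>w (k + 1) = w k - a k * (g k - y k)\<close>, where \<open>g k\<close> is the gradient at the extrapolated point. That
  point differs from \<open>w k\<close> by multiples of \<open>d k\<close> and \<open>y k\<close>, so \<open>w\<close> is a perturbed gradient descent.\<close>

lemma momentum_trajectory_dichotomy:
  fixes f :: "'a::euclidean_space \<Rightarrow> real" and x e y :: "nat \<Rightarrow> 'a" and a S :: "nat \<Rightarrow> real"
  assumes diff: "\<forall>z. f differentiable (at z)" and lip: "L-lipschitz_on UNIV (grad f)"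
    and bdd: "bdd_below (range f)" and loj: "\<forall>z\<in>crit f. Lojasiewicz_at f z"
    and lam: "0 \<le> lam" "lam < 1"
    and a: "\<And>k. 0 < a k" "\<And>k. a (Suc k) \<le> a k" "a \<longlonglongrightarrow> 0" "\<not> summable a"
    and small: "\<And>k. L * a k \<le> 1" "\<And>k. L * \<bar>\<nu> - lam / (1 - lam)\<bar> * a k \<le> (1 - lam) / 2"
    and S: "\<And>k. 1 \<le> S k" "\<And>k. S (Suc k) = S k + a (Suc k)" and q: "1 < q"
    and x: "\<And>k. x (Suc (Suc k)) = x (Suc k)
      - ((1 - lam) * a k) *\<^sub>R (grad f (x (Suc k) + \<nu> *\<^sub>R (x (Suc k) - x k)) - e k)
      + lam *\<^sub>R (x (Suc k) - x k)"
    and y: "\<And>k. y (Suc k) = (1 - a k) *\<^sub>R y k + a k *\<^sub>R e k"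
    and y_lim: "y \<longlonglongrightarrow> 0" and y_sum: "summable (\<lambda>k. a k * (S k powr q * (norm (y k))\<^sup>2))"
    and e_sum: "summable (\<lambda>k. S k powr q * (norm (a k *\<^sub>R e k))\<^sup>2)"
  shows "filterlim (\<lambda>k. norm (x k)) at_top sequentially \<or> (\<exists>z\<in>crit f. x \<longlonglongrightarrow> z)"
proof -
  define \<kappa> where "\<kappa> = lam / (1 - lam)"
  define d where "d k = x (Suc k) - x k" for k
  define xt where "xt k = x (Suc k) + \<nu> *\<^sub>R d k" for k
  define w where "w k = x (Suc k) + \<kappa> *\<^sub>R d k - y k" for k
  define \<rho> where "\<rho> k = norm (y k) + norm (a k *\<^sub>R e k)" for k
  define c where "c = \<bar>\<nu> - \<kappa>\<bar>"
  have L: "0 \<le> L" using lip by (rule lipschitz_on_nonneg)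
  have d_Suc: "d (Suc k) = lam *\<^sub>R d k - ((1 - lam) * a k) *\<^sub>R (grad f (xt k) - e k)" for k
    using x[of k] by (simp add: d_def xt_def)
  have w_Suc: "w (Suc k) - w k = - (a k *\<^sub>R (grad f (xt k) - y k))" for k
  proof -
    have \<kappa>: "1 + \<kappa> = 1 / (1 - lam)" "(1 + \<kappa>) * lam = \<kappa>" "(1 + \<kappa>) * ((1 - lam) * a k) = a k"
      using lam by (auto simp: \<kappa>_def field_simps)
    have "w (Suc k) = x (Suc k) + (1 + \<kappa>) *\<^sub>R d (Suc k) - y (Suc k)"
      by (simp add: w_def d_def[of "Suc k"] algebra_simps)
    also have "(1 + \<kappa>) *\<^sub>R d (Suc k) = \<kappa> *\<^sub>R d k - a k *\<^sub>R (grad f (xt k) - e k)"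
      unfolding d_Suc scaleR_diff_right[of "1 + \<kappa>" "lam *\<^sub>R d k"] scaleR_scaleR \<kappa>(2,3) ..
    finally show ?thesis by (simp add: w_def y algebra_simps)
  qed
  have lip_xt: "norm (grad f (xt k) - grad f (w k)) \<le> L * (c * norm (d k) + norm (y k))" for k
  proof -
    have "norm (grad f (xt k) - grad f (w k)) \<le> L * norm (xt k - w k)"
      using lipschitz_onD[OF lip, of "xt k" "w k"] by (simp add: dist_norm)
    also have "xt k - w k = (\<nu> - \<kappa>) *\<^sub>R d k + y k"
      by (simp add: xt_def w_def algebra_simps)
    also have "L * norm ((\<nu> - \<kappa>) *\<^sub>R d k + y k) \<le> L * (c * norm (d k) + norm (y k))"
      using L norm_triangle_ineq[of "(\<nu> - \<kappa>) *\<^sub>R d k" "y k"]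
      by (intro mult_left_mono) (auto simp: c_def)
    finally show ?thesis .
  qed
  have c: "0 \<le> c" by (simp add: c_def)
  have rho_nonneg: "0 \<le> \<rho> k" for k by (simp add: \<rho>_def)
  have ae_lim: "(\<lambda>k. norm (a k *\<^sub>R e k)) \<longlonglongrightarrow> 0"
  proof -
    have "(\<lambda>k. (norm (a k *\<^sub>R e k))\<^sup>2) \<longlonglongrightarrow> 0"
    proof (rule tendsto_sandwich[OF _ _ tendsto_const summable_LIMSEQ_zero[OF e_sum]])
      have "1 * (norm (a k *\<^sub>R e k))\<^sup>2 \<le> S k powr q * (norm (a k *\<^sub>R e k))\<^sup>2" for k
        using S(1)[of k] q by (intro mult_right_mono ge_one_powr_ge_zero) auto
      then show "\<forall>\<^sub>F k in sequentially. (norm (a k *\<^sub>R e k))\<^sup>2 \<le> S k powr q * (norm (a k *\<^sub>R e k))\<^sup>2"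
        by simp
    qed simp
    then have "(\<lambda>k. sqrt ((norm (a k *\<^sub>R e k))\<^sup>2)) \<longlonglongrightarrow> sqrt 0" by (intro tendsto_real_sqrt)
    then show ?thesis by simp
  qed
  have rho_weighted: "summable (\<lambda>k. S k powr q * (a k * (\<rho> k)\<^sup>2))"
  proof (rule summable_comparison_test)
    show "summable (\<lambda>k. 2 * (a k * (S k powr q * (norm (y k))\<^sup>2))
        + 2 * (a 0 * (S k powr q * (norm (a k *\<^sub>R e k))\<^sup>2)))"
      by (intro summable_add summable_mult y_sum e_sum)
    show "\<exists>N. \<forall>k\<ge>N. norm (S k powr q * (a k * (\<rho> k)\<^sup>2)) \<le> 2 * (a k * (S k powr q * (norm (y k))\<^sup>2))
        + 2 * (a 0 * (S k powr q * (norm (a k *\<^sub>R e k))\<^sup>2))"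
    proof (intro exI allI impI)
      fix k
      have a0: "a k \<le> a 0" using lift_Suc_antimono_le[of a 0 k] a(2) by simp
      have "S k powr q * (a k * (\<rho> k)\<^sup>2)
          \<le> S k powr q * (a k * (2 * (norm (y k))\<^sup>2 + 2 * (norm (a k *\<^sub>R e k))\<^sup>2))"
        unfolding \<rho>_def using a(1)[of k] by (intro mult_left_mono square_sum_le) auto
      also have "\<dots> = 2 * (a k * (S k powr q * (norm (y k))\<^sup>2))
          + 2 * (a k * (S k powr q * (norm (a k *\<^sub>R e k))\<^sup>2))"
        by (simp add: distrib_left mult_ac)
      also have "\<dots> \<le> 2 * (a k * (S k powr q * (norm (y k))\<^sup>2))
          + 2 * (a 0 * (S k powr q * (norm (a k *\<^sub>R e k))\<^sup>2))"
        using a0 by (intro add_left_mono mult_left_mono mult_right_mono) auto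
      finally show "norm (S k powr q * (a k * (\<rho> k)\<^sup>2)) \<le> 2 * (a k * (S k powr q * (norm (y k))\<^sup>2))
          + 2 * (a 0 * (S k powr q * (norm (a k *\<^sub>R e k))\<^sup>2))"
        using a(1)[of k] by simp
    qed
  qed
  have rho_summable: "summable (\<lambda>k. a k * (\<rho> k)\<^sup>2)"
  proof (rule summable_comparison_test[OF _ rho_weighted])
    have "1 * (a k * (\<rho> k)\<^sup>2) \<le> S k powr q * (a k * (\<rho> k)\<^sup>2)" for k
      using S(1)[of k] q a(1)[of k] by (intro mult_right_mono ge_one_powr_ge_zero) auto
    then show "\<exists>N. \<forall>k\<ge>N. norm (a k * (\<rho> k)\<^sup>2) \<le> S k powr q * (a k * (\<rho> k)\<^sup>2)"
      using a(1) by (simp add: less_imp_le)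
  qed
  interpret perturbed_descent f L "L * c + L + 1" "(1 + lam) / 2" "(1 + 1 / q) / 2" a \<rho>
    "\<lambda>k. norm (d k)" w
  proof
    show "0 < (1 + 1 / q) / 2" "(1 + 1 / q) / 2 < 1" using q by (auto simp: field_simps)
    show "summable (\<lambda>k. a k * (\<Sum>j. a (j + k) * (\<rho> (j + k))\<^sup>2) powr ((1 + 1 / q) / 2))"
    proof (rule weighted_tails_powr_summable[where t = "\<lambda>k. a k * (\<rho> k)\<^sup>2"])
      show "0 < S k" for k using S(1)[of k] by simp
    qed (use q a S rho_weighted rho_summable in \<open>auto simp: less_imp_le\<close>)
    have "(\<lambda>k. norm (y k) + norm (a k *\<^sub>R e k)) \<longlonglongrightarrow> 0 + 0"
      by (intro tendsto_add tendsto_norm_zero y_lim ae_lim)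
    then show "\<rho> \<longlonglongrightarrow> 0" by (simp add: \<rho>_def[abs_def])
    show "norm (w (Suc k) - w k + a k *\<^sub>R grad f (w k))
        \<le> a k * ((L * c + L + 1) * (norm (d k) + \<rho> k))" for k
    proof -
      have "w (Suc k) - w k + a k *\<^sub>R grad f (w k) = - (a k *\<^sub>R (grad f (xt k) - grad f (w k) - y k))"
        unfolding w_Suc by (simp add: algebra_simps)
      then have "norm (w (Suc k) - w k + a k *\<^sub>R grad f (w k))
          = a k * norm (grad f (xt k) - grad f (w k) - y k)"
        using a(1)[of k] by (simp only: norm_minus_cancel norm_scaleR abs_of_pos)
      also have "\<dots> \<le> a k * (L * (c * norm (d k) + norm (y k)) + norm (y k))"
        using a(1)[of k] lip_xt[of k] norm_triangle_ineq4[of "grad f (xt k) - grad f (w k)" "y k"]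
        by (intro mult_left_mono) auto
      also have "\<dots> \<le> a k * ((L * c + L + 1) * (norm (d k) + \<rho> k))"
      proof (rule mult_left_mono)
        have "L * (c * norm (d k) + norm (y k)) + norm (y k)
            = (L * c) * norm (d k) + (L + 1) * norm (y k)" by (simp add: algebra_simps)
        also have "\<dots> \<le> (L * c + L + 1) * norm (d k) + (L * c + L + 1) * norm (y k)"
          using L c by (intro add_mono mult_right_mono) auto
        also have "\<dots> \<le> (L * c + L + 1) * norm (d k) + (L * c + L + 1) * \<rho> k"
          using L c by (intro add_left_mono mult_left_mono) (auto simp: \<rho>_def)
        finally show "L * (c * norm (d k) + norm (y k)) + norm (y k)
            \<le> (L * c + L + 1) * (norm (d k) + \<rho> k)" by (simp add: algebra_simps)
      qed (use a(1)[of k] in simp)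
      finally show ?thesis .
    qed
    show "norm (d (Suc k)) \<le> (1 + lam) / 2 * norm (d k) + (a k * norm (grad f (w k)) + \<rho> k)" for k
    proof -
      have g: "norm (grad f (xt k)) \<le> norm (grad f (w k)) + L * (c * norm (d k) + norm (y k))"
        using lip_xt[of k] norm_triangle_ineq2[of "grad f (xt k)" "grad f (w k)"] by linarith
      have "norm (d (Suc k)) \<le> norm (lam *\<^sub>R d k) + norm (((1 - lam) * a k) *\<^sub>R (grad f (xt k) - e k))"
        unfolding d_Suc by (rule norm_triangle_ineq4)
      also have "\<dots> = lam * norm (d k) + ((1 - lam) * a k) * norm (grad f (xt k) - e k)"
        using lam a(1)[of k] by (simp add: abs_mult)
      also have "((1 - lam) * a k) * norm (grad f (xt k) - e k)
          \<le> a k * (norm (grad f (xt k)) + norm (e k))"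
        using lam a(1)[of k] norm_triangle_ineq4[of "grad f (xt k)" "e k"]
        by (intro mult_mono) (auto simp: mult_left_le_one_le)
      also have "\<dots> \<le> a k * (norm (grad f (w k)) + L * (c * norm (d k) + norm (y k)) + norm (e k))"
        using a(1)[of k] g by (intro mult_left_mono) auto
      also have "\<dots> = a k * norm (grad f (w k)) + (L * c * a k) * norm (d k)
          + (L * a k) * norm (y k) + norm (a k *\<^sub>R e k)"
        using a(1)[of k] by (simp add: algebra_simps)
      also have "\<dots> \<le> a k * norm (grad f (w k)) + ((1 - lam) / 2) * norm (d k)
          + 1 * norm (y k) + norm (a k *\<^sub>R e k)"
        using small[of k] by (intro add_mono mult_right_mono order_refl) (auto simp: c_def \<kappa>_def)
      finally show ?thesis by (simp add: \<rho>_def field_simps)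
    qed
  qed (use diff lip bdd loj lam q a rho_nonneg rho_summable in auto)
  have gap: "(\<lambda>k. x (Suc k) - w k) \<longlonglongrightarrow> 0"
  proof -
    have "(\<lambda>k. y k - \<kappa> *\<^sub>R d k) \<longlonglongrightarrow> 0 - \<kappa> *\<^sub>R 0"
      by (intro tendsto_intros y_lim tendsto_norm_zero_cancel[OF delta_lim])
    then show ?thesis by (simp add: w_def)
  qed
  from diverges_or_converges_to_critical_point show ?thesis
  proof
    assume w: "filterlim (\<lambda>k. norm (w k)) at_top sequentially"
    have "(\<lambda>k. - norm (x (Suc k) - w k)) \<longlonglongrightarrow> - 0"
      by (intro tendsto_minus tendsto_norm_zero gap)
    then have "filterlim (\<lambda>k. - norm (x (Suc k) - w k) + norm (w k)) at_top sequentially"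
      by (rule filterlim_tendsto_add_at_top[OF _ w])
    then have "filterlim (\<lambda>k. norm (x (Suc k))) at_top sequentially"
    proof (rule filterlim_at_top_mono)
      have "- norm (x (Suc k) - w k) + norm (w k) \<le> norm (x (Suc k))" for k
        using norm_triangle_ineq2[of "w k" "x (Suc k)"] norm_minus_commute[of "w k" "x (Suc k)"]
        by linarith
      then show "\<forall>\<^sub>F k in sequentially. - norm (x (Suc k) - w k) + norm (w k) \<le> norm (x (Suc k))"
        by simp
    qed
    then show ?thesis
      using filterlim_sequentially_Suc[of "\<lambda>k. norm (x k)" at_top] by simp
  next
    assume "\<exists>z\<in>crit f. w \<longlonglongrightarrow> z"
    then obtain z where z: "z \<in> crit f" "w \<longlonglongrightarrow> z" by blast
    have "(\<lambda>k. (x (Suc k) - w k) + w k) \<longlonglongrightarrow> 0 + z" by (intro tendsto_add gap z)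
    then have "(\<lambda>k. x (Suc k)) \<longlonglongrightarrow> z" by simp
    then have "x \<longlonglongrightarrow> z" by (rule LIMSEQ_imp_Suc)
    then show ?thesis using z by blast
  qed
qed

section \<open>The stochastic process\<close>

lemma space_natural_filtration [simp]: "space (natural_filtration M x k) = space M"
  unfolding natural_filtration_def by (rule space_measure_of) auto

lemma sets_natural_filtration:
  "sets (natural_filtration M x k) =
    sigma_sets (space M) {x i -` A \<inter> space M | i A. i \<le> k \<and> A \<in> sets borel}"
  unfolding natural_filtration_def by (rule sets_measure_of) auto

lemma measurable_natural_filtration:
  "i \<le> k \<Longrightarrow> x i \<in> borel_measurable (natural_filtration M x k)"
  by (rule measurableI) (auto simp: sets_natural_filtration intro!: sigma_sets.Basic)

lemma subalgebra_natural_filtration: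
  assumes "\<And>i. x i \<in> borel_measurable M"
  shows "subalgebra M (natural_filtration M x k)"
  unfolding subalgebra_def sets_natural_filtration
  using assms by (auto intro!: sets.sigma_sets_subset measurable_sets)

lemma subalgebra_natural_filtration_mono:
  assumes "i \<le> j"
  shows "subalgebra (natural_filtration M x j) (natural_filtration M x i)"
proof -
  have "{x l -` A \<inter> space M | l A. l \<le> i \<and> A \<in> sets borel}
      \<subseteq> {x l -` A \<inter> space M | l A. l \<le> j \<and> A \<in> sets borel}"
    using assms by (smt (verit) Collect_mono_iff le_trans)
  then show ?thesis
    unfolding subalgebra_def sets_natural_filtration space_natural_filtration
    by (intro conjI refl sigma_sets_mono')
qed

lemma vec_cond_exp_scaleR_zero:
  fixes X :: "'w \<Rightarrow> 'a::euclidean_space"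
  assumes "sigma_finite_subalgebra M F" and int: "integrable M X"
    and zero: "AE \<omega> in M. vec_cond_exp M F X \<omega> = 0"
  shows "AE \<omega> in M. vec_cond_exp M F (\<lambda>\<omega>. c *\<^sub>R X \<omega>) \<omega> = 0"
proof -
  interpret sigma_finite_subalgebra M F by fact
  have "AE \<omega> in M. \<forall>b\<in>Basis.
      real_cond_exp M F (\<lambda>\<omega>. c * (X \<omega> \<bullet> b)) \<omega> = c * real_cond_exp M F (\<lambda>\<omega>. X \<omega> \<bullet> b) \<omega>"
  proof (rule AE_finite_allI[OF finite_Basis])
    fix b :: 'a
    have "integrable M (\<lambda>\<omega>. X \<omega> \<bullet> b)" using int by (rule integrable_inner_left)
    then show "AE \<omega> in M.
        real_cond_exp M F (\<lambda>\<omega>. c * (X \<omega> \<bullet> b)) \<omega> = c * real_cond_exp M F (\<lambda>\<omega>. X \<omega> \<bullet> b) \<omega>"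
      by (rule real_cond_exp_cmult)
  qed
  with zero show ?thesis
  proof eventually_elim
    case (elim \<omega>)
    have "vec_cond_exp M F (\<lambda>\<omega>. c *\<^sub>R X \<omega>) \<omega> = c *\<^sub>R vec_cond_exp M F X \<omega>"
      using elim(2) unfolding vec_cond_exp_def scaleR_sum_right by (intro sum.cong) auto
    then show ?case using elim by simp
  qed
qed

lemma (in finite_measure_subalgebra) second_moment_bound_of_conditional:
  fixes X :: "'a \<Rightarrow> 'b::euclidean_space"
  assumes [measurable]: "X \<in> borel_measurable M" and prob: "emeasure M (space M) = 1"
    and cond: "AE \<omega> in M. nn_cond_exp M F (\<lambda>\<omega>. ennreal ((norm (X \<omega>))\<^sup>2)) \<omega> \<le> ennreal s"
    and s: "0 \<le> s"
  shows "integrable M (\<lambda>\<omega>. (norm (X \<omega>))\<^sup>2)" "(\<integral>\<omega>. (norm (X \<omega>))\<^sup>2 \<partial>M) \<le> s"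
proof -
  have "(\<integral>\<^sup>+\<omega>. ennreal ((norm (X \<omega>))\<^sup>2) \<partial>M) =
      (\<integral>\<^sup>+\<omega>. nn_cond_exp M F (\<lambda>\<omega>. ennreal ((norm (X \<omega>))\<^sup>2)) \<omega> \<partial>M)"
    using nn_cond_exp_intg[of "\<lambda>_. 1" "\<lambda>\<omega>. ennreal ((norm (X \<omega>))\<^sup>2)"] by simp
  also have "\<dots> \<le> (\<integral>\<^sup>+\<omega>. ennreal s \<partial>M)" by (rule nn_integral_mono_AE[OF cond])
  also have "\<dots> = ennreal s" using prob by simp
  finally have le: "(\<integral>\<^sup>+\<omega>. ennreal ((norm (X \<omega>))\<^sup>2) \<partial>M) \<le> ennreal s" .
  then show int: "integrable M (\<lambda>\<omega>. (norm (X \<omega>))\<^sup>2)"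
    by (intro integrableI_bounded) (auto intro: le_less_trans)
  have "ennreal (\<integral>\<omega>. (norm (X \<omega>))\<^sup>2 \<partial>M) \<le> ennreal s"
    using le nn_integral_eq_integral[OF int] by simp
  then show "(\<integral>\<omega>. (norm (X \<omega>))\<^sup>2 \<partial>M) \<le> s" using s by (simp add: ennreal_le_iff)
qed

text \<open>A limit in the closed set of critical points can be detected by countably many conditions: the
  sequence is Cauchy and its gradients tend to zero.\<close>

lemma converges_to_crit_iff:
  fixes f :: "'a::euclidean_space \<Rightarrow> real" and x :: "nat \<Rightarrow> 'a"
  assumes "continuous_on UNIV (grad f)"
  shows "(\<exists>z\<in>crit f. x \<longlonglongrightarrow> z) \<longleftrightarrow>
    (\<forall>j. \<exists>M. \<forall>m\<ge>M. \<forall>n\<ge>M. dist (x m) (x n) < inverse (real (Suc j))) \<and>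
    (\<forall>j. \<exists>M. \<forall>n\<ge>M. norm (grad f (x n)) < inverse (real (Suc j)))"
proof -
  have cont: "(\<lambda>n. grad f (x n)) \<longlonglongrightarrow> grad f z" if "x \<longlonglongrightarrow> z" for z
  proof -
    have "isCont (grad f) z" using assms by (simp add: continuous_on_eq_continuous_at)
    then show ?thesis using that by (rule isCont_tendsto_compose)
  qed
  have zero: "(\<forall>j. \<exists>M. \<forall>n\<ge>M. norm (grad f (x n)) < inverse (real (Suc j))) \<longleftrightarrow>
      (\<lambda>n. grad f (x n)) \<longlonglongrightarrow> 0" (is "?A \<longleftrightarrow> ?B")
  proof
    assume A: ?A
    show ?B
    proof (rule LIMSEQ_I)
      fix r :: real assume "0 < r"
      then obtain j where "inverse (real (Suc j)) < r" using reals_Archimedean by blast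
      moreover obtain K where "\<forall>n\<ge>K. norm (grad f (x n)) < inverse (real (Suc j))" using A by blast
      ultimately have "\<forall>n\<ge>K. norm (grad f (x n) - 0) < r" by (auto intro: less_trans)
      then show "\<exists>no. \<forall>n\<ge>no. norm (grad f (x n) - 0) < r" by blast
    qed
  next
    assume ?B
    then have "\<exists>M. \<forall>n\<ge>M. norm (grad f (x n) - 0) < inverse (real (Suc j))" for j
      by (rule LIMSEQ_D) simp
    then show ?A by simp
  qed
  have "(\<exists>z\<in>crit f. x \<longlonglongrightarrow> z) \<longleftrightarrow> Cauchy x \<and> (\<lambda>n. grad f (x n)) \<longlonglongrightarrow> 0"
  proof
    assume "\<exists>z\<in>crit f. x \<longlonglongrightarrow> z"
    then obtain z where z: "x \<longlonglongrightarrow> z" "grad f z = 0" by (auto simp: crit_def)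
    then show "Cauchy x \<and> (\<lambda>n. grad f (x n)) \<longlonglongrightarrow> 0"
      using cont[OF z(1)] LIMSEQ_imp_Cauchy[OF z(1)] by simp
  next
    assume *: "Cauchy x \<and> (\<lambda>n. grad f (x n)) \<longlonglongrightarrow> 0"
    then obtain z where z: "x \<longlonglongrightarrow> z" using Cauchy_convergent convergent_def by blast
    then have "grad f z = 0" using cont * LIMSEQ_unique by blast
    then show "\<exists>z\<in>crit f. x \<longlonglongrightarrow> z" using z by (auto simp: crit_def)
  qed
  then show ?thesis using zero by (simp only: metric_Cauchy_iff2)
qed

lemma measurable_dichotomy:
  fixes f :: "'a::euclidean_space \<Rightarrow> real"
  assumes cont: "continuous_on UNIV (grad f)" and [measurable]: "\<And>k. x k \<in> borel_measurable M"
  shows "Measurable.pred M (\<lambda>\<omega>. filterlim (\<lambda>k. norm (x k \<omega>)) at_top sequentially \<or>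
    (\<exists>z\<in>crit f. (\<lambda>k. x k \<omega>) \<longlonglongrightarrow> z))"
proof -
  have [measurable]: "grad f \<in> borel_measurable borel"
    using cont by (rule borel_measurable_continuous_onI)
  have "filterlim X at_top sequentially \<longleftrightarrow> (\<forall>j::nat. \<exists>N. \<forall>n\<ge>N. real j \<le> X n)" for X :: "nat \<Rightarrow> real"
  proof
    assume "filterlim X at_top sequentially"
    then show "\<forall>j::nat. \<exists>N. \<forall>n\<ge>N. real j \<le> X n"
      by (auto simp: filterlim_at_top eventually_sequentially)
  next
    assume *: "\<forall>j::nat. \<exists>N. \<forall>n\<ge>N. real j \<le> X n"
    show "filterlim X at_top sequentially"
      unfolding filterlim_at_top eventually_sequentially
    proof
      fix Z obtain j :: nat where "Z \<le> real j" using real_arch_simple by blast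
      then show "\<exists>N. \<forall>n\<ge>N. Z \<le> X n" using * by (meson order_trans)
    qed
  qed
  then show ?thesis
    unfolding converges_to_crit_iff[OF cont] by simp measurable
qed

fun averaged_noise :: "(nat \<Rightarrow> real) \<Rightarrow> (nat \<Rightarrow> 'w \<Rightarrow> 'a::real_vector) \<Rightarrow> nat \<Rightarrow> 'w \<Rightarrow> 'a" where
  "averaged_noise a e 0 \<omega> = 0"
| "averaged_noise a e (Suc k) \<omega> = (1 - a k) *\<^sub>R averaged_noise a e k \<omega> + a k *\<^sub>R e k \<omega>"

lemma SGDM_step:
  assumes "SGDM M f \<alpha> lam \<nu> x0 e x" and "\<omega> \<in> space M"
  shows "x (Suc (Suc k)) \<omega> = x (Suc k) \<omega>
      - \<alpha> (Suc k) *\<^sub>R (grad f (x (Suc k) \<omega> + \<nu> *\<^sub>R (x (Suc k) \<omega> - x k \<omega>)) - e (Suc k) \<omega>)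
      + lam *\<^sub>R (x (Suc k) \<omega> - x k \<omega>)"
proof -
  have "\<forall>k\<ge>1. x (k + 1) \<omega> = x k \<omega>
      - \<alpha> k *\<^sub>R (grad f (x k \<omega> + \<nu> *\<^sub>R (x k \<omega> - x (k - 1) \<omega>)) - e k \<omega>)
      + lam *\<^sub>R (x k \<omega> - x (k - 1) \<omega>)"
    using assms unfolding SGDM_def Let_def by blast
  from this[rule_format, of "Suc k"] show ?thesis by simp
qed

lemma SGDM_measurable:
  fixes f :: "'a::euclidean_space \<Rightarrow> real"
  assumes sgdm: "SGDM M f \<alpha> lam \<nu> x0 e x" and cont: "continuous_on UNIV (grad f)"
    and e: "\<And>k. e (Suc k) \<in> borel_measurable M"
  shows "x k \<in> borel_measurable M"
proof -
  have [measurable]: "grad f \<in> borel_measurable borel"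
    using cont by (rule borel_measurable_continuous_onI)
  have [measurable]: "e (Suc k) \<in> borel_measurable M" for k by (rule e)
  have "x k \<in> borel_measurable M \<and> x (Suc k) \<in> borel_measurable M"
  proof (induction k)
    case 0
    have "x 0 \<omega> = x0" "x (Suc 0) \<omega> = x0" if "\<omega> \<in> space M" for \<omega>
      using sgdm that by (auto simp: SGDM_def)
    then show ?case by (simp cong: measurable_cong)
  next
    case (Suc k)
    then have [measurable]: "x k \<in> borel_measurable M" "x (Suc k) \<in> borel_measurable M" by auto
    have "x (Suc (Suc k)) \<in> borel_measurable M"
      by (subst measurable_cong[OF SGDM_step[OF sgdm]]) measurable
    then show ?case by simp
  qed
  then show ?thesis ..
qed

text \<open>An error can be read off from three consecutive iterates, because the step size is not zero.\<close>

lemma SGDM_error_adapted: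
  fixes f :: "'a::euclidean_space \<Rightarrow> real"
  assumes sgdm: "SGDM M f \<alpha> lam \<nu> x0 e x" and cont: "continuous_on UNIV (grad f)"
    and \<alpha>: "0 < \<alpha> (Suc k)"
  shows "e (Suc k) \<in> borel_measurable (natural_filtration M x (Suc (Suc k)))"
proof -
  let ?F = "natural_filtration M x (Suc (Suc k))"
  have [measurable]: "grad f \<in> borel_measurable borel"
    using cont by (rule borel_measurable_continuous_onI)
  have [measurable]: "x k \<in> borel_measurable ?F" "x (Suc k) \<in> borel_measurable ?F"
      "x (Suc (Suc k)) \<in> borel_measurable ?F"
    by (simp_all add: measurable_natural_filtration)
  have "e (Suc k) \<omega> = (1 / \<alpha> (Suc k)) *\<^sub>R (x (Suc (Suc k)) \<omega> - x (Suc k) \<omega> - lam *\<^sub>R (x (Suc k) \<omega> - x k \<omega>))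
      + grad f (x (Suc k) \<omega> + \<nu> *\<^sub>R (x (Suc k) \<omega> - x k \<omega>))" if "\<omega> \<in> space ?F" for \<omega>
  proof -
    have "\<omega> \<in> space M" using that by simp
    from SGDM_step[OF sgdm this, of k]
    have "x (Suc (Suc k)) \<omega> - x (Suc k) \<omega> - lam *\<^sub>R (x (Suc k) \<omega> - x k \<omega>)
        = \<alpha> (Suc k) *\<^sub>R (e (Suc k) \<omega> - grad f (x (Suc k) \<omega> + \<nu> *\<^sub>R (x (Suc k) \<omega> - x k \<omega>)))"
      by (simp add: algebra_simps)
    then show ?thesis using \<alpha> by simp
  qed
  then show ?thesis by (subst measurable_cong) measurable
qed

theorem theorem4p2:
  fixes M :: "'w measure"
    and f :: "real ^ 'd \<Rightarrow> real"
    and x0 :: "real ^ 'd"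
    and x e :: "nat \<Rightarrow> 'w \<Rightarrow> real ^ 'd"
    and \<alpha> :: "nat \<Rightarrow> real"
    and L lam \<nu> \<sigma> r :: real
  assumes "prob_space M"
    and "\<forall>z. f differentiable (at z)"
    and "bdd_below (range f)"
    and "L > 0" and "L-lipschitz_on UNIV (grad f)"
    and "\<forall>z\<in>crit f. Lojasiewicz_at f z"
    and "0 \<le> lam" and "lam < 1" and "0 \<le> \<nu>"
    and "SGDM M f \<alpha> lam \<nu> x0 e x"
    and "0 \<le> \<sigma>" and "stochastic_errors M (natural_filtration M x) \<sigma> e"
    and "\<forall>k\<ge>1. 0 < \<alpha> k" and "\<forall>k\<ge>1. \<alpha> (k + 1) \<le> \<alpha> k"
    and "filterlim (\<lambda>n. \<Sum>k=1..n. \<alpha> k) at_top sequentially"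
    and "r > 1/2"
    and "summable (\<lambda>k. (\<alpha> (k + 1))\<^sup>2 * (\<Sum>i=1..k+1. \<alpha> i) powr (2 * r))"
  shows "\<P>(\<omega> in M. filterlim (\<lambda>k. norm (x k \<omega>)) at_top sequentially \<or>
                     (\<exists>z\<in>crit f. (\<lambda>k. x k \<omega>) \<longlonglongrightarrow> z)) = 1"
proof -
  interpret prob_space M by fact
  note diff = assms(2) and lip = assms(5) and sgdm = assms(10) and errors = assms(12)
  have lam: "0 \<le> lam" "lam < 1" by fact+
  have cont: "continuous_on UNIV (grad f)" using lip by (rule lipschitz_on_continuous_on)
  have e_meas: "e (Suc k) \<in> borel_measurable M" for k
    using errors by (simp add: stochastic_errors_def)
  have x_meas: "x k \<in> borel_measurable M" for k
    by (rule SGDM_measurable[OF sgdm cont e_meas])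
  have subalg: "subalgebra M (natural_filtration M x k)" for k
    by (rule subalgebra_natural_filtration[OF x_meas])

  define s where "s n = (\<Sum>i=1..n. \<alpha> i)" for n
  define q where "q = 2 * r"
  have q: "1 < q" using assms(16) by (simp add: q_def)
  have \<alpha>: "0 < \<alpha> (Suc k)" "\<alpha> (Suc (Suc k)) \<le> \<alpha> (Suc k)" for k
    using assms(13,14) by (auto dest: spec[of _ "Suc k"])
  have s_lim: "filterlim s at_top sequentially" using assms(15) by (simp add: s_def[abs_def])
  have s_sum: "summable (\<lambda>k. (\<alpha> (Suc k))\<^sup>2 * s (Suc k) powr q)"
    using assms(17) by (simp add: s_def q_def)
  have s_Suc: "s (Suc n) = s n + \<alpha> (Suc n)" for n by (simp add: s_def)

  \<comment> \<open>The step sizes tend to zero because the weighted sum converges although the weights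
    tend to infinity.\<close>
  have "(\<lambda>k. (\<alpha> (Suc k))\<^sup>2) \<longlonglongrightarrow> 0"
  proof (rule tendsto_sandwich[OF _ _ tendsto_const summable_LIMSEQ_zero[OF s_sum]])
    have "\<forall>\<^sub>F k in sequentially. 1 \<le> s (Suc k)"
      using s_lim by (subst eventually_sequentially_Suc) (simp add: filterlim_at_top)
    then show "\<forall>\<^sub>F k in sequentially. (\<alpha> (Suc k))\<^sup>2 \<le> (\<alpha> (Suc k))\<^sup>2 * s (Suc k) powr q"
    proof eventually_elim
      case (elim k)
      then have "1 \<le> s (Suc k) powr q" using q by (intro ge_one_powr_ge_zero) auto
      then show ?case using mult_left_mono[of 1 "s (Suc k) powr q" "(\<alpha> (Suc k))\<^sup>2"] by simp
    qed
  qed simp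
  then have "(\<lambda>k. sqrt ((\<alpha> (Suc k))\<^sup>2)) \<longlonglongrightarrow> sqrt 0" by (intro tendsto_real_sqrt)
  then have \<alpha>_lim: "(\<lambda>k. \<alpha> (Suc k)) \<longlonglongrightarrow> 0" using \<alpha>(1) by (simp add: less_imp_le)

  define \<kappa> where "\<kappa> = \<bar>\<nu> - lam / (1 - lam)\<bar>"
  define b where "b k = \<alpha> (Suc k) / (1 - lam)" for k
  have "b \<longlonglongrightarrow> 0 / (1 - lam)" unfolding b_def by (intro tendsto_intros \<alpha>_lim) (use lam in auto)
  then have b_lim: "b \<longlonglongrightarrow> 0" by simp
  have lims: "(\<lambda>k. L * b k) \<longlonglongrightarrow> L * 0" "(\<lambda>k. L * \<kappa> * b k) \<longlonglongrightarrow> L * \<kappa> * 0"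
    by (intro tendsto_intros b_lim)+
  have "\<forall>\<^sub>F k in sequentially. b k < 1" using order_tendstoD(2)[OF b_lim] by simp
  moreover have "\<forall>\<^sub>F k in sequentially. L * b k < 1" using order_tendstoD(2)[OF lims(1)] by simp
  moreover have "\<forall>\<^sub>F k in sequentially. L * \<kappa> * b k < (1 - lam) / 2"
    by (rule order_tendstoD(2)[OF lims(2)]) (use lam in simp)
  moreover have "\<forall>\<^sub>F k in sequentially. 2 * q * (1 - lam) \<le> s (Suc k)"
    using s_lim by (subst eventually_sequentially_Suc) (simp add: filterlim_at_top)
  ultimately have "\<forall>\<^sub>F k in sequentially. b k < 1 \<and> L * b k < 1 \<and> L * \<kappa> * b k < (1 - lam) / 2 \<and>
      2 * q * (1 - lam) \<le> s (Suc k)"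
    by eventually_elim simp
  then obtain N where N: "\<And>k. k \<ge> N \<Longrightarrow> b k < 1 \<and> L * b k < 1 \<and> L * \<kappa> * b k < (1 - lam) / 2 \<and>
      2 * q * (1 - lam) \<le> s (Suc k)"
    by (auto simp: eventually_sequentially)

  \<comment> \<open>From time \<open>N\<close> on, the steps are small and the elapsed time is large. The convergence analysis
    starts there.\<close>
  define a where "a k = b (k + N)" for k
  define S where "S k = s (Suc (k + N)) / (1 - lam)" for k
  define E where "E k = e (Suc (k + N))" for k
  define F where "F k = natural_filtration M x (Suc (k + N))" for k
  have a: "0 < a k" "a (Suc k) \<le> a k" "a k \<le> 1" "L * a k \<le> 1" "L * \<kappa> * a k \<le> (1 - lam) / 2" for k
    using N[of "k + N"] \<alpha> lam by (auto simp: a_def b_def divide_right_mono)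
  have S: "2 * q \<le> S k" "S (Suc k) = S k + a (Suc k)" for k
  proof -
    show "2 * q \<le> S k" using N[of "k + N"] lam by (simp add: S_def pos_le_divide_eq)
    show "S (Suc k) = S k + a (Suc k)"
      by (simp add: S_def a_def b_def s_Suc[of "Suc (k + N)"] add_divide_distrib)
  qed
  have a_le_S: "a k \<le> S k" for k
    using S(1)[of k] a(3)[of k] q by linarith
  have S_lim: "filterlim S at_top sequentially"
  proof -
    have "filterlim (\<lambda>k. s (k + Suc N)) at_top sequentially"
      by (rule filterlim_compose[OF s_lim filterlim_add_const_nat_at_top])
    then have "filterlim (\<lambda>k. (1 / (1 - lam)) * s (k + Suc N)) at_top sequentially"
      using lam by (intro filterlim_tendsto_pos_mult_at_top[OF tendsto_const]) auto
    then show ?thesis by (simp add: S_def[abs_def])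
  qed
  have a_lim: "a \<longlonglongrightarrow> 0" unfolding a_def by (rule LIMSEQ_ignore_initial_segment[OF b_lim])
  have a_div: "\<not> summable a"
  proof
    assume "summable a"
    then have "Bseq (\<lambda>n. sum a {..<n})"
      using summable_LIMSEQ convergent_def convergent_imp_Bseq by blast
    then obtain B where B: "\<And>n. \<bar>sum a {..<n}\<bar> \<le> B" unfolding Bseq_def by auto
    have "S n = S 0 + sum a {..<Suc n} - a 0" for n
      by (induction n) (simp_all add: S(2))
    then have le: "S n \<le> S 0 + B" for n using B[of "Suc n"] a(1)[of 0] by (smt (verit))
    have "\<forall>\<^sub>F n in sequentially. S 0 + B + 1 \<le> S n" using S_lim by (simp add: filterlim_at_top)
    then obtain n where "S 0 + B + 1 \<le> S n" using eventually_happens by force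
    then show False using le[of n] by simp
  qed
  have a_sum: "summable (\<lambda>k. (a k)\<^sup>2 * S k powr q)"
  proof -
    have "summable (\<lambda>k. (\<alpha> (Suc (k + N)))\<^sup>2 * s (Suc (k + N)) powr q)"
      using s_sum by (rule summable_ignore_initial_segment)
    then have "summable (\<lambda>k. (1 / ((1 - lam)\<^sup>2 * (1 - lam) powr q)) *
        ((\<alpha> (Suc (k + N)))\<^sup>2 * s (Suc (k + N)) powr q))" by (rule summable_mult)
    moreover have "(1 / ((1 - lam)\<^sup>2 * (1 - lam) powr q)) *
        ((\<alpha> (Suc (k + N)))\<^sup>2 * s (Suc (k + N)) powr q) = (a k)\<^sup>2 * S k powr q" for k
    proof -
      have "0 < s (Suc (k + N)) / (1 - lam)" using S(1)[of k] q by (simp add: S_def)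
      then have "0 \<le> s (Suc (k + N))" using lam by (simp add: zero_less_divide_iff)
      then show ?thesis
        using lam by (simp add: a_def b_def S_def powr_divide power_divide)
    qed
    ultimately show ?thesis by (simp only:)
  qed

  have F_finite: "finite_measure_subalgebra M (F k)" for k
    by unfold_locales (simp add: F_def subalg)
  have E_meas: "E k \<in> borel_measurable M" for k by (simp add: E_def e_meas)
  have E_cond: "AE \<omega> in M. vec_cond_exp M (F k) (E k) \<omega> = 0"
      "AE \<omega> in M. nn_cond_exp M (F k) (\<lambda>\<omega>. ennreal ((norm (E k \<omega>))\<^sup>2)) \<omega> \<le> ennreal (\<sigma>\<^sup>2)" for k
    using errors by (auto simp: stochastic_errors_def E_def F_def)
  have E_moment: "integrable M (\<lambda>\<omega>. (norm (E k \<omega>))\<^sup>2)" "(\<integral>\<omega>. (norm (E k \<omega>))\<^sup>2 \<partial>M) \<le> \<sigma>\<^sup>2" for k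
    using finite_measure_subalgebra.second_moment_bound_of_conditional[OF F_finite E_meas
        emeasure_space_1 E_cond(2)] by auto
  have E_int: "integrable M (E k)" for k
  proof -
    have "integrable M (\<lambda>\<omega>. 1 + (norm (E k \<omega>))\<^sup>2)" using E_moment(1) by simp
    moreover have "norm (E k \<omega>) \<le> 1 + (norm (E k \<omega>))\<^sup>2" for \<omega>
    proof -
      have "2 * norm (E k \<omega>) \<le> 1 + (norm (E k \<omega>))\<^sup>2"
        using zero_le_power2[of "norm (E k \<omega>) - 1"] by (simp add: power2_diff)
      then show ?thesis using norm_ge_zero[of "E k \<omega>"] by linarith
    qed
    ultimately show ?thesis
      using E_meas by (rule_tac Bochner_Integration.integrable_bound) auto
  qed
  interpret damped_martingale M F "\<lambda>k \<omega>. a k *\<^sub>R E k \<omega>" "averaged_noise a E" "\<lambda>k. 1 - a k"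
  proof
    show "subalgebra M (F k)" for k by (simp add: F_def subalg)
    show "subalgebra (F (Suc k)) (F k)" for k
      by (simp add: F_def subalgebra_natural_filtration_mono)
    show "(\<lambda>\<omega>. a k *\<^sub>R E k \<omega>) \<in> borel_measurable (F (Suc k))" for k
      using SGDM_error_adapted[OF sgdm cont \<alpha>(1), of "k + N"] by (simp add: E_def F_def)
    show "integrable M (\<lambda>\<omega>. (norm (a k *\<^sub>R E k \<omega>))\<^sup>2)" for k
      using E_moment(1) by (simp add: power_mult_distrib)
    show "AE \<omega> in M. vec_cond_exp M (F k) (\<lambda>\<omega>. a k *\<^sub>R E k \<omega>) \<omega> = 0" for k
      using finite_measure_subalgebra_is_sigma_finite[OF F_finite]
        E_int E_cond(1) by (rule vec_cond_exp_scaleR_zero)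
    show "\<bar>1 - a k\<bar> \<le> 1" for k using a(1,3)[of k] by simp
  qed simp_all
  have "AE \<omega> in M. (\<lambda>k. averaged_noise a E k \<omega>) \<longlonglongrightarrow> 0
      \<and> summable (\<lambda>k. a k * (S k powr q * (norm (averaged_noise a E k \<omega>))\<^sup>2))
      \<and> summable (\<lambda>k. S k powr q * (norm (a k *\<^sub>R E k \<omega>))\<^sup>2)"
  proof (rule noise_averages_out)
    show "(\<integral>\<omega>. (norm (a k *\<^sub>R E k \<omega>))\<^sup>2 \<partial>M) \<le> \<sigma>\<^sup>2 * (a k)\<^sup>2" for k
      using mult_left_mono[OF E_moment(2)[of k], of "(a k)\<^sup>2"]
      by (simp add: power_mult_distrib mult.commute)
  qed (use q a S a_le_S S_lim a_sum in auto)
  with AE_space have "AE \<omega> in M. filterlim (\<lambda>k. norm (x k \<omega>)) at_top sequentially \<or>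
      (\<exists>z\<in>crit f. (\<lambda>k. x k \<omega>) \<longlonglongrightarrow> z)"
  proof eventually_elim
    case (elim \<omega>)
    have "filterlim (\<lambda>k. norm (x (k + N) \<omega>)) at_top sequentially \<or>
        (\<exists>z\<in>crit f. (\<lambda>k. x (k + N) \<omega>) \<longlonglongrightarrow> z)"
    proof (rule momentum_trajectory_dichotomy[where a = a and S = S and q = q and lam = lam
          and \<nu> = \<nu> and L = L and e = "\<lambda>k. E k \<omega>" and y = "\<lambda>k. averaged_noise a E k \<omega>"])
      show "x (Suc (Suc k) + N) \<omega> = x (Suc k + N) \<omega>
          - ((1 - lam) * a k) *\<^sub>R (grad f (x (Suc k + N) \<omega> + \<nu> *\<^sub>R (x (Suc k + N) \<omega> - x (k + N) \<omega>)) - E k \<omega>)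
          + lam *\<^sub>R (x (Suc k + N) \<omega> - x (k + N) \<omega>)" for k
        using SGDM_step[OF sgdm elim(1), of "k + N"] lam by (simp add: a_def b_def E_def)
      show "1 \<le> S k" for k using S(1)[of k] q by linarith
      show "L * \<bar>\<nu> - lam / (1 - lam)\<bar> * a k \<le> (1 - lam) / 2" for k
        using a(5)[of k] by (simp add: \<kappa>_def)
    qed (use assms lam a a_lim a_div S q elim in auto)
    then show ?case
    proof
      assume "filterlim (\<lambda>k. norm (x (k + N) \<omega>)) at_top sequentially"
      then have "filterlim (\<lambda>k. norm (x k \<omega>)) at_top sequentially"
        unfolding filterlim_at_top
        using eventually_sequentially_seg[of "\<lambda>k. Z \<le> norm (x k \<omega>)" N for Z] by simp
      then show ?thesis ..
    next
      assume "\<exists>z\<in>crit f. (\<lambda>k. x (k + N) \<omega>) \<longlonglongrightarrow> z"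
      then show ?thesis using LIMSEQ_offset[of "\<lambda>k. x k \<omega>" N] by blast
    qed
  qed
  then show ?thesis
    using measurable_dichotomy[OF cont x_meas] by (simp add: prob_Collect_eq_1 pred_def)
qed

end
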